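(* Fix $k\in\{1,2,\dots,n\}$ and assume that all traditional products have the same price, $r_i=r$ for all $i\in\mathcal N=\{1,\dots,n\}$. Let $S^*$ be the optimal assortment of the problem $$\max_{S\subseteq\mathcal N}\ \max_{\rho\ge 0}\ \mathrm{Rev}\big(\mathrm{Opq}_{(k)}(S,\bm r_S,\rho)\big).$$ Assume without loss of generality that the intrinsic valuations are ordered, i.e., $v_1\ge v_2\ge\cdots\ge v_n$. Then there exists $j\in\{k,k+1,\dots,n\}$ such that $S^*=\{1,\dots,j\}$.
   Context: Setting. $\mathcal N=\{1,\dots,n\}$ is a set of (traditional) products with intrinsic valuations $v_i\in\mathbb R$ and nonnegative prices $r_i$. Customer valuations are $V_i=v_i+\epsilon_i$ for $i\in\mathcal N$ and $V_0=\epsilon_0$ for the no-purchase option $0$, with $\epsilon_0,\dots,\epsilon_n$ i.i.d. Gumbel$(0,1)$. For $S\subseteq\mathcal N$, $\bm r_S=(r_i)_{i\in S}$; utilities are $U_i=V_i-r_i$ and $U_0=V_0$. Opaque-MNL model with full support, $\mathrm{Opq}_{(k)}(S,\bm r_S,\rho)$: the products of $S$ are offered at prices $\bm r_S$ together with an opaque product $q$ at price $\rho$. The customer's valuation of $q$ is $V_{(k)}^S$, the $k$-th smallest value among $\{V_j:j\in S\}$, with the convention $V_{(k)}^S=\max_{j\in S}V_j$ if $k>|S|$ (if $S=\emptyset$ then nothing is sold and the revenue is $0$). The utility of $q$ is $U_q=V_{(k)}^S-\rho$. The customer chooses the option of highest utility in $S\cup\{0,q\}$, ties between $q$ and another option being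 broken in favor of $q$. With $\pi(\cdot)$ the resulting choice probabilities, $\mathrm{Rev}(\mathrm{Opq}_{(k)}(S,\bm r_S,\rho))=\sum_{i\in S}r_i\,\pi(i)+\rho\,\pi(q)$. *)

theory Defs
  imports "HOL-Probability.Probability"
begin

definition gumbel_distributed :: "'a measure \<Rightarrow> ('a \<Rightarrow> real) \<Rightarrow> bool" where
  "gumbel_distributed M X \<longleftrightarrow>
     X \<in> borel_measurable M \<and>
     (\<forall>x. measure M {\<omega> \<in> space M. X \<omega> \<le> x} = exp (- exp (- x)))"

definition iid_gumbel :: "'a measure \<Rightarrow> nat set \<Rightarrow> (nat \<Rightarrow> 'a \<Rightarrow> real) \<Rightarrow> bool" where
  "iid_gumbel M I \<epsilon> \<longleftrightarrow>
     prob_space.indep_vars M (\<lambda>_. borel) \<epsilon> I \<and> (\<forall>i\<in>I. gumbel_distributed M (\<epsilon> i))"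

text \<open>Index 0 is the no-purchase option (its intrinsic valuation and its price are 0, whatever
  the values of v and r at 0); the traditional products have indices 1, ..., n.\<close>

definition valuation :: "(nat \<Rightarrow> real) \<Rightarrow> (nat \<Rightarrow> 'a \<Rightarrow> real) \<Rightarrow> 'a \<Rightarrow> nat \<Rightarrow> real" where
  "valuation v \<epsilon> \<omega> i = (if i = 0 then \<epsilon> 0 \<omega> else v i + \<epsilon> i \<omega>)"

definition utility :: "(nat \<Rightarrow> real) \<Rightarrow> (nat \<Rightarrow> real) \<Rightarrow> nat \<Rightarrow> real" where
  "utility r V i = (if i = 0 then V 0 else V i - r i)"

text \<open>The k-th smallest valuation in S, counted from k = 1 and with multiplicity; it is only
  meaningful for finite nonempty S.\<close>

definition opaque_valuation :: "nat \<Rightarrow> nat set \<Rightarrow> (nat \<Rightarrow> real) \<Rightarrow> real" where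
  "opaque_valuation k S V =
     (if k \<le> card S then sort (map V (sorted_list_of_set S)) ! (k - 1) else Max (V ` S))"

definition opaque_utility :: "nat \<Rightarrow> nat set \<Rightarrow> real \<Rightarrow> (nat \<Rightarrow> real) \<Rightarrow> real" where
  "opaque_utility k S \<rho> V = opaque_valuation k S V - \<rho>"

text \<open>The weak inequality for q and the strict inequality against q in the choice of i implement
  the tie-breaking in favor of q. Ties among traditional products and the no-purchase option are
  null events in the model, so it is immaterial that no one is taken to buy in that case.\<close>

definition chooses_opaque ::
    "nat \<Rightarrow> nat set \<Rightarrow> (nat \<Rightarrow> real) \<Rightarrow> real \<Rightarrow> (nat \<Rightarrow> real) \<Rightarrow> bool" where
  "chooses_opaque k S r \<rho> V \<longleftrightarrow>
     (\<forall>j \<in> insert 0 S. utility r V j \<le> opaque_utility k S \<rho> V)"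

definition chooses_product ::
    "nat \<Rightarrow> nat set \<Rightarrow> (nat \<Rightarrow> real) \<Rightarrow> real \<Rightarrow> (nat \<Rightarrow> real) \<Rightarrow> nat \<Rightarrow> bool" where
  "chooses_product k S r \<rho> V i \<longleftrightarrow>
     opaque_utility k S \<rho> V < utility r V i \<and>
     (\<forall>j \<in> insert 0 S - {i}. utility r V j < utility r V i)"

definition prob_opaque ::
    "'a measure \<Rightarrow> (nat \<Rightarrow> real) \<Rightarrow> (nat \<Rightarrow> 'a \<Rightarrow> real) \<Rightarrow> nat \<Rightarrow> nat set \<Rightarrow>
     (nat \<Rightarrow> real) \<Rightarrow> real \<Rightarrow> real" where
  "prob_opaque M v \<epsilon> k S r \<rho> =
     measure M {\<omega> \<in> space M. chooses_opaque k S r \<rho> (valuation v \<epsilon> \<omega>)}"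

definition prob_product ::
    "'a measure \<Rightarrow> (nat \<Rightarrow> real) \<Rightarrow> (nat \<Rightarrow> 'a \<Rightarrow> real) \<Rightarrow> nat \<Rightarrow> nat set \<Rightarrow>
     (nat \<Rightarrow> real) \<Rightarrow> real \<Rightarrow> nat \<Rightarrow> real" where
  "prob_product M v \<epsilon> k S r \<rho> i =
     measure M {\<omega> \<in> space M. chooses_product k S r \<rho> (valuation v \<epsilon> \<omega>) i}"

definition Rev_Opq ::
    "'a measure \<Rightarrow> (nat \<Rightarrow> real) \<Rightarrow> (nat \<Rightarrow> 'a \<Rightarrow> real) \<Rightarrow> nat \<Rightarrow> nat set \<Rightarrow>
     (nat \<Rightarrow> real) \<Rightarrow> real \<Rightarrow> real" where
  "Rev_Opq M v \<epsilon> k S r \<rho> =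
     (if S = {} then 0
      else (\<Sum>i\<in>S. r i * prob_product M v \<epsilon> k S r \<rho> i) + \<rho> * prob_opaque M v \<epsilon> k S r \<rho>)"

text \<open>S is the assortment component of a maximizer (S, \<rho>) of the joint problem; in particular
  the maximum is attained.\<close>

definition optimal_assortment ::
    "'a measure \<Rightarrow> (nat \<Rightarrow> real) \<Rightarrow> (nat \<Rightarrow> 'a \<Rightarrow> real) \<Rightarrow> nat \<Rightarrow> nat \<Rightarrow>
     (nat \<Rightarrow> real) \<Rightarrow> nat set \<Rightarrow> bool" where
  "optimal_assortment M v \<epsilon> k n r S \<longleftrightarrow>
     S \<subseteq> {1..n} \<and>
     (\<exists>\<rho>\<ge>0. \<forall>S'\<subseteq>{1..n}. \<forall>\<rho>'\<ge>0. Rev_Opq M v \<epsilon> k S' r \<rho>' \<le> Rev_Opq M v \<epsilon> k S r \<rho>)"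

end

theory Submission
  imports Defs
begin

text \<open>
  The numbers exp (- V i) are independent exponentials with rates exp (v i). Translating all of them
  by t, using memorylessness and letting t tend to 0 yields, for an opaque price \<rho> \<le> r,
  e^r \<pi>(S) + e^\<rho> \<pi>(q) = W \<pi>(0), where W is the sum of exp (v i) over S. Hence the revenue
  is determined by W and the no-purchase probability \<pi>(0): it equals the revenue without discount
  plus (r - \<kappa> (e^r + W)) (e^r / (e^r + W) - \<pi>(0)), where \<kappa> = (r - \<rho>) / (e^r - e^\<rho>) and
  the second factor is nonnegative. So raising W without raising \<pi>(0) strictly raises the best
  revenue. Replacing a product by one of larger intrinsic valuation does this, by coupling; so does
  adding a product when fewer than k are offered, since then q is always a best product and
  \<pi>(0) = e^\<rho> / (e^\<rho> + W). Therefore an optimal assortment has at least k products, and they have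
  the largest valuations.
\<close>

section \<open>The opaque valuation as an order statistic\<close>

text \<open>The share of \<open>q\<close> is an integral over order statistics, and raising a
  valuation may move customers from the full price to the discount, so revenues cannot be compared
  event by event. What coupling controls is \<pi>(0). The translation identity and total probability
  one are two linear equations for \<pi>(S) and \<pi>(q); this is how both shares are eliminated.
  The coefficient of \<pi>(0) in the revenue, \<kappa> (e^r + W) - r, can have either sign; \<kappa>
  is the reciprocal slope of the chord of exp over [\<rho>, r]. A smaller \<pi>(0) thus need not
  help at the same opaque price, and the comparison must allow a retreat to the price r. Enlargement
  stops at \<open>k\<close> products because a further product can lower the \<open>k\<close>-th
  smallest valuation and thereby raise \<pi>(0). With equal valuations an optimal set is an initial
  segment only up to a permutation preserving \<open>v\<close>. At r = 0 all revenues vanish, so in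
  that case the claim is only that some initial segment is optimal.\<close>

lemma length_filter_less_sorted_iff:
  fixes xs :: "'a::linorder list"
  assumes "sorted xs" "k < length xs"
  shows "c \<le> xs ! k \<longleftrightarrow> length (filter (\<lambda>x. x < c) xs) \<le> k"
proof
  assume c: "c \<le> xs ! k"
  have "{i. i < length xs \<and> xs ! i < c} \<subseteq> {..<k}"
  proof
    fix i assume i: "i \<in> {i. i < length xs \<and> xs ! i < c}"
    show "i \<in> {..<k}"
    proof (rule ccontr)
      assume "i \<notin> {..<k}"
      then have "xs ! k \<le> xs ! i" using i assms by (intro sorted_nth_mono) auto
      with i c show False by auto
    qed
  qed
  then have "card {i. i < length xs \<and> xs ! i < c} \<le> k"
    using card_mono[of "{..<k}"] by fastforce
  then show "length (filter (\<lambda>x. x < c) xs) \<le> k"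
    by (simp add: length_filter_conv_card)
next
  assume l: "length (filter (\<lambda>x. x < c) xs) \<le> k"
  show "c \<le> xs ! k"
  proof (rule ccontr)
    assume "\<not> c \<le> xs ! k"
    then have "xs ! i < c" if "i \<le> k" for i
      using sorted_nth_mono[OF assms(1) that assms(2)] by auto
    then have "{..k} \<subseteq> {i. i < length xs \<and> xs ! i < c}"
      using assms by auto
    then have "card {..k} \<le> card {i. i < length xs \<and> xs ! i < c}"
      by (intro card_mono) auto
    with l show False by (simp add: length_filter_conv_card)
  qed
qed

text \<open>Counting turns later facts about the order statistic into comparisons of cardinalities.
  The bound \<open>min k (card S)\<close> covers both branches of the definition: for
  \<open>k > card S\<close> the count must miss at least one element, which characterizes the
  maximum.\<close>

lemma le_opaque_valuation_iff:
  assumes "finite S" "S \<noteq> {}" "1 \<le> k"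
  shows "c \<le> opaque_valuation k S V \<longleftrightarrow> card {i\<in>S. V i < c} < min k (card S)"
proof (cases "k \<le> card S")
  case True
  let ?xs = "map V (sorted_list_of_set S)"
  have l: "length (filter (\<lambda>x. x < c) (sort ?xs)) = card {i\<in>S. V i < c}"
  proof -
    have "distinct (filter (\<lambda>i. V i < c) (sorted_list_of_set S))"
      by (intro distinct_filter) simp
    from distinct_card[OF this] show ?thesis
      using assms(1) by (simp add: filter_sort filter_map o_def)
  qed
  have "c \<le> sort ?xs ! (k - 1) \<longleftrightarrow> card {i\<in>S. V i < c} \<le> k - 1"
    unfolding l[symmetric] using True assms by (intro length_filter_less_sorted_iff) auto
  then show ?thesis using True assms unfolding opaque_valuation_def by auto
next
  case False
  have "c \<le> Max (V ` S) \<longleftrightarrow> (\<exists>i\<in>S. c \<le> V i)"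
    using assms by (subst Max_ge_iff) auto
  also have "\<dots> \<longleftrightarrow> {i\<in>S. V i < c} \<noteq> S" by force
  also have "\<dots> \<longleftrightarrow> card {i\<in>S. V i < c} < card S"
    using assms by (metis (no_types, lifting) mem_Collect_eq nless_le psubset_card_mono psubsetI
        subsetI)
  finally show ?thesis using False unfolding opaque_valuation_def by auto
qed

lemma opaque_valuation_in:
  assumes "finite S" "S \<noteq> {}" "1 \<le> k"
  shows "opaque_valuation k S V \<in> V ` S"
proof (cases "k \<le> card S")
  case True
  then have "sort (map V (sorted_list_of_set S)) ! (k - 1) \<in> set (sort (map V (sorted_list_of_set S)))"
    using assms by (intro nth_mem) auto
  then show ?thesis using True assms by (auto simp: opaque_valuation_def)
next
  case False
  then show ?thesis using assms by (auto simp: opaque_valuation_def)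
qed

lemma opaque_valuation_le_Max:
  assumes "finite S" "S \<noteq> {}" "1 \<le> k"
  shows "opaque_valuation k S V \<le> Max (V ` S)"
  using opaque_valuation_in[OF assms] assms by auto

text \<open>The counting criterion transfers along \<open>g\<close> only for bounds in the range of
  \<open>g\<close>, which need not be all of the reals (a later instance is
  \<open>\<lambda>z. - exp (- z)\<close>). Hence the first inequality tests the attained value
  \<open>g (V i)\<close>.\<close>

lemma opaque_valuation_strict_mono:
  assumes "finite S" "S \<noteq> {}" "1 \<le> k" and g: "strict_mono g"
  shows "opaque_valuation k S (\<lambda>i. g (V i)) = g (opaque_valuation k S V)"
proof (rule antisym)
  note iff = le_opaque_valuation_iff[OF assms(1-3)]
  obtain i where i: "i \<in> S" "opaque_valuation k S (\<lambda>i. g (V i)) = g (V i)"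
    using opaque_valuation_in[OF assms(1-3), of "\<lambda>i. g (V i)"] by auto
  then have "V i \<le> opaque_valuation k S V"
    using iff[of "g (V i)" "\<lambda>i. g (V i)"] iff[of "V i" V] by (simp add: strict_mono_less[OF g])
  with i show "opaque_valuation k S (\<lambda>i. g (V i)) \<le> g (opaque_valuation k S V)"
    by (simp add: strict_mono_less_eq[OF g])
  show "g (opaque_valuation k S V) \<le> opaque_valuation k S (\<lambda>i. g (V i))"
    using iff[of "opaque_valuation k S V" V] by (simp add: iff strict_mono_less[OF g])
qed

lemma opaque_valuation_mono:
  assumes "finite S" "S \<noteq> {}" "1 \<le> k" "\<And>i. i \<in> S \<Longrightarrow> V i \<le> V' i"
  shows "opaque_valuation k S V \<le> opaque_valuation k S V'"
proof -
  note iff = le_opaque_valuation_iff[OF assms(1-3)]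
  let ?c = "opaque_valuation k S V"
  have "card {i\<in>S. V' i < ?c} \<le> card {i\<in>S. V i < ?c}"
    using assms by (intro card_mono) (auto intro: le_less_trans)
  then show ?thesis using iff[of ?c V] iff[of ?c V'] by auto
qed

lemma opaque_valuation_reindex:
  assumes "finite S" "S \<noteq> {}" "1 \<le> k" "bij_betw \<sigma> S T"
  shows "opaque_valuation k T V = opaque_valuation k S (\<lambda>i. V (\<sigma> i))"
proof -
  have T: "finite T" "T \<noteq> {}" "card T = card S"
    using assms bij_betw_finite bij_betw_empty1 bij_betw_same_card
    by (auto simp: bij_betw_def card_image)
  have "card {i\<in>T. V i < c} = card {i\<in>S. V (\<sigma> i) < c}" for c
  proof -
    have "{i\<in>T. V i < c} = \<sigma> ` {i\<in>S. V (\<sigma> i) < c}"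
      using assms by (auto simp: bij_betw_def)
    moreover have "inj_on \<sigma> {i\<in>S. V (\<sigma> i) < c}"
      using assms(4) by (auto simp: bij_betw_def inj_on_def)
    ultimately show ?thesis by (simp add: card_image)
  qed
  then have "c \<le> opaque_valuation k T V \<longleftrightarrow> c \<le> opaque_valuation k S (\<lambda>i. V (\<sigma> i))" for c
    using le_opaque_valuation_iff[OF T(1,2) assms(3)] le_opaque_valuation_iff[OF assms(1-3)] T(3)
    by simp
  then show ?thesis by (meson antisym order_refl)
qed

text \<open>The boundary \<open>card S = k\<close> matters: there the definition still sorts, and
  the \<open>k\<close>-th smallest value is the last one.\<close>

lemma opaque_valuation_eq_Max:
  assumes "finite S" "S \<noteq> {}" "1 \<le> k" "card S \<le> k"
  shows "opaque_valuation k S V = Max (V ` S)"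
proof (rule antisym[OF opaque_valuation_le_Max[OF assms(1-3)]])
  have "card {i\<in>S. V i < Max (V ` S)} < card S"
  proof -
    obtain i where "i \<in> S" "V i = Max (V ` S)"
      by (metis (mono_tags, lifting) Max_in assms(1,2) finite_imageI image_iff image_is_empty)
    then have "i \<notin> {i\<in>S. V i < Max (V ` S)}" by simp
    with \<open>i \<in> S\<close> have "{i\<in>S. V i < Max (V ` S)} \<subset> S" by blast
    then show ?thesis using assms by (intro psubset_card_mono) auto
  qed
  then show "Max (V ` S) \<le> opaque_valuation k S V"
    using assms by (simp add: le_opaque_valuation_iff)
qed

lemma opaque_valuation_cong:
  assumes "\<And>i. i \<in> S \<Longrightarrow> V i = V' i" "finite S"
  shows "opaque_valuation k S V = opaque_valuation k S V'"
proof -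
  have "map V (sorted_list_of_set S) = map V' (sorted_list_of_set S)" "V ` S = V' ` S"
    using assms by auto
  then show ?thesis by (simp only: opaque_valuation_def)
qed

text \<open>Superlevel sets avoid sorting: membership depends on the number of values below
  \<open>c\<close>, a finite sum of indicators.\<close>

lemma borel_measurable_opaque_valuation:
  assumes "finite S" "S \<noteq> {}" "1 \<le> k" and m[measurable]: "\<And>i. i \<in> S \<Longrightarrow> V i \<in> borel_measurable N"
  shows "(\<lambda>x. opaque_valuation k S (\<lambda>i. V i x)) \<in> borel_measurable N"
proof (subst borel_measurable_iff_ge, intro allI)
  fix c :: real
  have "(\<Sum>i\<in>S. indicator {..<c} (V i x)) = real (card {i\<in>S. V i x < c})" for x
    using assms(1) by (simp add: indicator_def sum.If_cases Int_def)
  then have *: "{x \<in> space N. c \<le> opaque_valuation k S (\<lambda>i. V i x)} =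
    {x \<in> space N. (\<Sum>i\<in>S. indicator {..<c} (V i x)) < real (min k (card S))}"
    by (simp add: le_opaque_valuation_iff[OF assms(1-3)] del: of_nat_min)
  show "{x \<in> space N. c \<le> opaque_valuation k S (\<lambda>i. V i x)} \<in> sets N"
    unfolding * by measurable
qed

section \<open>Products of exponential distributions\<close>

lemma borel_measurable_pred_le [measurable (raw)]:
  fixes f g :: "'a \<Rightarrow> real"
  shows "f \<in> borel_measurable M \<Longrightarrow> g \<in> borel_measurable M \<Longrightarrow> Measurable.pred M (\<lambda>w. f w \<le> g w)"
  unfolding pred_def by (rule borel_measurable_le)

definition exp1 :: "real measure" where
  "exp1 = density lborel (\<lambda>x. ennreal (exponential_density 1 x))"

lemma sets_exp1 [measurable_cong, simp]: "sets exp1 = sets borel"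
  and space_exp1 [simp]: "space exp1 = UNIV"
  by (simp_all add: exp1_def)

lemma prob_space_exp1: "prob_space exp1"
  unfolding exp1_def by (rule prob_space_exponential_density) simp

interpretation exp1: prob_space exp1 by (rule prob_space_exp1)
interpretation exp1_PiM: product_prob_space "\<lambda>_. exp1" UNIV by unfold_locales

lemma prob_space_PiM_exp1: "prob_space (PiM S (\<lambda>_. exp1))"
  by (intro prob_space_PiM prob_space_exp1)

lemma sets_PiM_exp1 [measurable_cong]: "sets (PiM S (\<lambda>_. exp1)) = sets (PiM S (\<lambda>_. borel))"
  by (intro sets_PiM_cong) auto

text \<open>Translation by \<open>s\<close> multiplies the exponential density by exp (-s).
  Nonnegative integrals keep integrability conditions on \<open>f\<close> away.\<close>

lemma nn_integral_exp1_memoryless: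
  assumes [measurable]: "f \<in> borel_measurable borel" and s: "0 \<le> s"
  shows "(\<integral>\<^sup>+y. f (y + s) \<partial>exp1) = ennreal (exp s) * (\<integral>\<^sup>+y. f y * indicator {s<..} y \<partial>exp1)"
proof -
  have "(\<integral>\<^sup>+y. f y * indicator {s<..} y \<partial>exp1)
      = (\<integral>\<^sup>+y. ennreal (exponential_density 1 y) * (f y * indicator {s<..} y) \<partial>lborel)"
    by (simp add: exp1_def nn_integral_density)
  also have "\<dots> = (\<integral>\<^sup>+y. ennreal (exponential_density 1 (s + y)) * (f (s + y) * indicator {s<..} (s + y)) \<partial>lborel)"
    by (subst nn_integral_real_affine[where c=1 and t=s]) (auto simp: one_ennreal_def[symmetric])
  also have "\<dots> = (\<integral>\<^sup>+y. ennreal (exp (-s)) * (ennreal (exponential_density 1 y) * f (y + s)) \<partial>lborel)"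
  proof (intro nn_integral_cong_AE)
    \<comment> \<open>At \<open>y = 0\<close> the density is 1 while the open ray excludes the
      point, so the integrands agree only off a null set.\<close>
    show "AE y in lborel. ennreal (exponential_density 1 (s + y)) * (f (s + y) * indicator {s<..} (s + y))
      = ennreal (exp (-s)) * (ennreal (exponential_density 1 y) * f (y + s))"
      using AE_lborel_singleton[of 0]
    proof eventually_elim
      case (elim y)
      then show ?case using s
        by (auto simp: exponential_density_def indicator_def exp_add[symmetric] mult.assoc[symmetric]
            ennreal_mult[symmetric] add.commute simp flip: exp_minus)
    qed
  qed
  also have "\<dots> = ennreal (exp (-s)) * (\<integral>\<^sup>+y. f (y + s) \<partial>exp1)"
    by (simp add: exp1_def nn_integral_density nn_integral_cmult)
  finally show ?thesis
    by (simp add: mult.assoc[symmetric] ennreal_mult[symmetric] exp_minus[symmetric] exp_add[symmetric])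
qed

lemma AE_exp1_pos: "AE y in exp1. 0 < y"
  unfolding exp1_def by (subst AE_density) (use AE_lborel_singleton[of 0] in
    \<open>auto elim!: eventually_mono simp: exponential_density_def\<close>)

lemma AE_PiM_exp1_pos:
  assumes "finite S" shows "AE y in PiM S (\<lambda>_. exp1). \<forall>i\<in>S. 0 < y i"
  using assms
  by (intro AE_finite_allI AE_PiM_component prob_space_exp1 AE_exp1_pos) auto

text \<open>Fubini splits off the coordinate \<open>j\<close>; after the one-dimensional rule the
  inner integral is a function of the remaining coordinates, to which the induction hypothesis
  applies. Hence \<open>f\<close> varies in the induction. The restriction keeps the shifted vector
  in the product space.\<close>

lemma nn_integral_PiM_exp1_memoryless:
  assumes "finite S" and "\<And>i. i \<in> S \<Longrightarrow> 0 \<le> s i" and "f \<in> borel_measurable (PiM S (\<lambda>_. borel))"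
  shows "(\<integral>\<^sup>+y. f (\<lambda>i\<in>S. y i + s i) \<partial>PiM S (\<lambda>_. exp1))
    = ennreal (exp (\<Sum>i\<in>S. s i)) * (\<integral>\<^sup>+y. f y * indicator {y. \<forall>i\<in>S. s i < y i} y \<partial>PiM S (\<lambda>_. exp1))"
  using assms
proof (induction S arbitrary: f rule: finite_induct)
  case empty
  have "(\<lambda>i\<in>{}. y i + s i) = y" if "y \<in> space (PiM {} (\<lambda>_. exp1))" for y :: "'a \<Rightarrow> real"
    using that by (auto simp: space_PiM)
  then have "(\<integral>\<^sup>+y. f (\<lambda>i\<in>{}. y i + s i) \<partial>PiM {} (\<lambda>_. exp1)) = (\<integral>\<^sup>+y. f y \<partial>PiM {} (\<lambda>_. exp1))"
    by (intro nn_integral_cong) (simp only:)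
  then show ?case by (simp only:) simp
next
  case (insert j S)
  note [measurable] = insert.prems(2)
  let ?P = "\<lambda>S. PiM S (\<lambda>_. exp1)"
  let ?ind = "\<lambda>S. indicator {y. \<forall>i\<in>S. s i < y i} :: _ \<Rightarrow> ennreal"
  have s: "0 \<le> s j" using insert.prems by auto
  have ind: "?ind (insert j S) (x(j := y)) = ?ind S x * indicator {s j<..} y" for x y
    using insert.hyps by (auto simp: indicator_def)
  have [measurable]: "?ind (insert j S) \<in> borel_measurable (PiM (insert j S) (\<lambda>_. borel))"
    "?ind S \<in> borel_measurable (PiM S (\<lambda>_. borel))"
    using insert.hyps(1) by (measurable, auto)+
  have [measurable]: "(\<lambda>(x,y). f (x(j := y))) \<in> borel_measurable (PiM S (\<lambda>_. borel) \<Otimes>\<^sub>M borel)"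
    by measurable
  have upd: "(\<lambda>i\<in>insert j S. (x(j := y)) i + s i) = (\<lambda>i\<in>S. x i + s i)(j := y + s j)" for x y
    using insert.hyps by auto
  have "(\<integral>\<^sup>+y. f (\<lambda>i\<in>insert j S. y i + s i) \<partial>?P (insert j S))
      = (\<integral>\<^sup>+x. \<integral>\<^sup>+y. f (\<lambda>i\<in>insert j S. (x(j := y)) i + s i) \<partial>exp1 \<partial>?P S)"
    using insert.hyps by (intro exp1_PiM.product_nn_integral_insert) auto
  also have "\<dots> = (\<integral>\<^sup>+x. \<integral>\<^sup>+y. f ((\<lambda>i\<in>S. x i + s i)(j := y + s j)) \<partial>exp1 \<partial>?P S)"
    by (simp only: upd)
  also have "\<dots> = (\<integral>\<^sup>+x. ennreal (exp (s j)) * (\<integral>\<^sup>+y. f ((\<lambda>i\<in>S. x i + s i)(j := y)) * indicator {s j<..} y \<partial>exp1) \<partial>?P S)"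
    by (intro nn_integral_cong nn_integral_exp1_memoryless s) (auto simp: space_PiM)
  also have "\<dots> = ennreal (exp (s j)) * (\<integral>\<^sup>+x. (\<integral>\<^sup>+y. f ((\<lambda>i\<in>S. x i + s i)(j := y)) * indicator {s j<..} y \<partial>exp1) \<partial>?P S)"
    by (intro nn_integral_cmult) measurable
  also have "\<dots> = ennreal (exp (s j)) * (ennreal (exp (\<Sum>i\<in>S. s i)) *
      (\<integral>\<^sup>+x. (\<integral>\<^sup>+y. f (x(j := y)) * indicator {s j<..} y \<partial>exp1) * ?ind S x \<partial>?P S))"
    using insert.prems by (subst insert.IH) auto
  also have "(\<integral>\<^sup>+x. (\<integral>\<^sup>+y. f (x(j := y)) * indicator {s j<..} y \<partial>exp1) * ?ind S x \<partial>?P S)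
      = (\<integral>\<^sup>+x. (\<integral>\<^sup>+y. f (x(j := y)) * ?ind (insert j S) (x(j := y)) \<partial>exp1) \<partial>?P S)"
  proof (intro nn_integral_cong)
    fix x assume "x \<in> space (?P S)"
    then have [measurable]: "x \<in> space (PiM S (\<lambda>_. borel))" by (simp add: space_PiM)
    show "(\<integral>\<^sup>+y. f (x(j := y)) * indicator {s j<..} y \<partial>exp1) * ?ind S x
        = (\<integral>\<^sup>+y. f (x(j := y)) * ?ind (insert j S) (x(j := y)) \<partial>exp1)"
      unfolding ind by (subst nn_integral_multc[symmetric]) (auto simp: mult_ac)
  qed
  also have "ennreal (exp (s j)) * (ennreal (exp (\<Sum>i\<in>S. s i)) * z)
      = ennreal (exp (\<Sum>i\<in>insert j S. s i)) * z" for z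
    using insert.hyps by (simp add: exp_add ennreal_mult mult.assoc)
  also have "ennreal (exp (\<Sum>i\<in>insert j S. s i)) *
      (\<integral>\<^sup>+x. (\<integral>\<^sup>+y. f (x(j := y)) * ?ind (insert j S) (x(j := y)) \<partial>exp1) \<partial>?P S)
      = ennreal (exp (\<Sum>i\<in>insert j S. s i)) * (\<integral>\<^sup>+y. f y * ?ind (insert j S) y \<partial>?P (insert j S))"
    by (subst exp1_PiM.product_nn_integral_insert) (use insert.hyps in auto)
  finally show ?case .
qed

section \<open>Choice probabilities in exponential coordinates\<close>

text \<open>In multiplicative coordinates y i = exp (- \<epsilon> i), which are i.i.d. exponential, valuations turn into
  costs exp (- V i) = exp (- v i) * y i, and the outside option is taken iff y 0 is below the
  threshold, where G = exp r and b = exp \<rho>. Then opaque_cost is the k-th largest cost.\<close>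

definition min_cost :: "(nat \<Rightarrow> real) \<Rightarrow> nat set \<Rightarrow> (nat \<Rightarrow> real) \<Rightarrow> real" where
  "min_cost v S y = Min ((\<lambda>i. exp (- v i) * y i) ` S)"

definition opaque_cost :: "(nat \<Rightarrow> real) \<Rightarrow> nat \<Rightarrow> nat set \<Rightarrow> (nat \<Rightarrow> real) \<Rightarrow> real" where
  "opaque_cost v k S y = - opaque_valuation k S (\<lambda>i. - (exp (- v i) * y i))"

definition threshold ::
    "(nat \<Rightarrow> real) \<Rightarrow> nat \<Rightarrow> nat set \<Rightarrow> real \<Rightarrow> real \<Rightarrow> (nat \<Rightarrow> real) \<Rightarrow> real" where
  "threshold v k S G b y = min (b * opaque_cost v k S y) (G * min_cost v S y)"

text \<open>The smallest cost is the \<open>k\<close>-th largest for \<open>k = card S\<close>, so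
  positivity, monotonicity, translation, relabelling and measurability of \<open>min_cost\<close>
  are inherited from \<open>opaque_cost\<close>.\<close>

lemma min_cost_eq_opaque_cost:
  assumes "finite S" "S \<noteq> {}"
  shows "min_cost v S y = opaque_cost v (card S) S y"
proof -
  have "opaque_valuation (card S) S (\<lambda>i. - (exp (- v i) * y i)) = Max ((\<lambda>i. - (exp (- v i) * y i)) ` S)"
    using assms by (intro opaque_valuation_eq_Max) (auto simp: Suc_le_eq card_gt_0_iff)
  then show ?thesis
    using assms by (simp add: min_cost_def opaque_cost_def minus_Max_eq_Min image_image)
qed

lemma opaque_cost_eq_min_cost:
  assumes "finite S" "S \<noteq> {}" "1 \<le> k" "card S \<le> k"
  shows "opaque_cost v k S y = min_cost v S y"
  using assms by (simp add: min_cost_eq_opaque_cost opaque_cost_def opaque_valuation_eq_Max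
      Suc_le_eq card_gt_0_iff)

context
  fixes S :: "nat set" and k :: nat
  assumes S: "finite S" "S \<noteq> {}" "1 \<le> k"
begin

lemma card_S: "1 \<le> card S" using S by (simp add: Suc_le_eq card_gt_0_iff)

lemma min_cost_le_opaque_cost: "min_cost v S y \<le> opaque_cost v k S y"
  unfolding min_cost_eq_opaque_cost[OF S(1,2)] opaque_cost_def
    opaque_valuation_eq_Max[OF S(1,2) card_S order_refl] neg_le_iff_le
  by (rule opaque_valuation_le_Max[OF S])

lemma opaque_cost_in: "opaque_cost v k S y \<in> (\<lambda>i. exp (- v i) * y i) ` S"
  using opaque_valuation_in[OF S, of "\<lambda>i. - (exp (- v i) * y i)"] by (force simp: opaque_cost_def)

lemma opaque_cost_pos: "(\<And>i. i \<in> S \<Longrightarrow> 0 < y i) \<Longrightarrow> 0 < opaque_cost v k S y"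
  using opaque_cost_in[of v y] by auto

lemma opaque_cost_mono:
  assumes "\<And>i. i \<in> S \<Longrightarrow> exp (- v i) * y i \<le> exp (- v' i) * y' i"
  shows "opaque_cost v k S y \<le> opaque_cost v' k S y'"
  unfolding opaque_cost_def using assms by (auto intro!: opaque_valuation_mono S)

text \<open>Adding \<open>t * exp (v i)\<close> to \<open>y i\<close> adds the same amount
  \<open>t\<close> to every cost, and order statistics commute with translations.\<close>

lemma opaque_cost_shift:
  "opaque_cost v k S (\<lambda>i\<in>S. y i + t * exp (v i)) = opaque_cost v k S y + t"
proof -
  have "opaque_cost v k S (\<lambda>i\<in>S. y i + t * exp (v i))
    = - opaque_valuation k S (\<lambda>i. (\<lambda>z. z - t) (- (exp (- v i) * y i)))"
    unfolding opaque_cost_def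
    by (intro arg_cong[where f=uminus] opaque_valuation_cong S)
      (simp add: algebra_simps exp_minus_inverse[of "v _"] flip: exp_add)
  also have "\<dots> = - (opaque_valuation k S (\<lambda>i. - (exp (- v i) * y i)) - t)"
    by (subst opaque_valuation_strict_mono[OF S]) (auto simp: strict_mono_def)
  finally show ?thesis by (simp add: opaque_cost_def)
qed

lemma opaque_cost_reindex:
  assumes "bij_betw \<sigma> S T"
  shows "opaque_cost v k T y = opaque_cost (\<lambda>i. v (\<sigma> i)) k S (\<lambda>i. y (\<sigma> i))"
  unfolding opaque_cost_def by (subst opaque_valuation_reindex[OF S assms]) simp

lemma opaque_cost_cong:
  "(\<And>i. i \<in> S \<Longrightarrow> y i = y' i) \<Longrightarrow> opaque_cost v k S y = opaque_cost v k S y'"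
  unfolding opaque_cost_def by (intro arg_cong[where f=uminus] opaque_valuation_cong S) auto

lemma borel_measurable_opaque_cost:
  "opaque_cost v k S \<in> borel_measurable (PiM S (\<lambda>_. borel))"
  unfolding opaque_cost_def[abs_def]
  by (intro borel_measurable_uminus borel_measurable_opaque_valuation[OF S]) measurable

end

context
  fixes S :: "nat set" and k :: nat
  assumes S: "finite S" "S \<noteq> {}" "1 \<le> k"
begin

lemma min_cost_pos: "(\<And>i. i \<in> S \<Longrightarrow> 0 < y i) \<Longrightarrow> 0 < min_cost v S y"
  and min_cost_mono: "(\<And>i. i \<in> S \<Longrightarrow> exp (- v i) * y i \<le> exp (- v' i) * y' i) \<Longrightarrow>
    min_cost v S y \<le> min_cost v' S y'"
  and min_cost_shift: "min_cost v S (\<lambda>i\<in>S. y i + t * exp (v i)) = min_cost v S y + t"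
  and min_cost_reindex: "bij_betw \<sigma> S T \<Longrightarrow>
    min_cost v T y = min_cost (\<lambda>i. v (\<sigma> i)) S (\<lambda>i. y (\<sigma> i))"
  and min_cost_cong: "(\<And>i. i \<in> S \<Longrightarrow> y i = y' i) \<Longrightarrow> min_cost v S y = min_cost v S y'"
  and borel_measurable_min_cost: "min_cost v S \<in> borel_measurable (PiM S (\<lambda>_. borel))"
proof -
  note c = min_cost_eq_opaque_cost[OF S(1,2)] and k = S(1,2) card_S[OF S]
  show "(\<And>i. i \<in> S \<Longrightarrow> 0 < y i) \<Longrightarrow> 0 < min_cost v S y"
    unfolding c by (rule opaque_cost_pos[OF k])
  show "(\<And>i. i \<in> S \<Longrightarrow> exp (- v i) * y i \<le> exp (- v' i) * y' i) \<Longrightarrow>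
    min_cost v S y \<le> min_cost v' S y'"
    unfolding c by (rule opaque_cost_mono[OF k])
  show "min_cost v S (\<lambda>i\<in>S. y i + t * exp (v i)) = min_cost v S y + t"
    unfolding c by (rule opaque_cost_shift[OF k])
  show "min_cost v T y = min_cost (\<lambda>i. v (\<sigma> i)) S (\<lambda>i. y (\<sigma> i))" if "bij_betw \<sigma> S T"
  proof -
    have T: "finite T" "T \<noteq> {}" "card T = card S"
      using that S bij_betw_finite[OF that] bij_betw_same_card[OF that] by (auto simp: bij_betw_def)
    show ?thesis unfolding c min_cost_eq_opaque_cost[OF T(1,2)] T(3)
      by (rule opaque_cost_reindex[OF k that])
  qed
  show "(\<And>i. i \<in> S \<Longrightarrow> y i = y' i) \<Longrightarrow> min_cost v S y = min_cost v S y'"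
    unfolding c by (rule opaque_cost_cong[OF k])
  show "min_cost v S \<in> borel_measurable (PiM S (\<lambda>_. borel))"
    unfolding c[abs_def] by (rule borel_measurable_opaque_cost[OF k])
qed

lemma borel_measurable_threshold:
  "threshold v k S G b \<in> borel_measurable (PiM S (\<lambda>_. borel))"
  unfolding threshold_def[abs_def] 
  using borel_measurable_opaque_cost[OF S, measurable] borel_measurable_min_cost[measurable] by measurable

lemma threshold_pos:
  "0 < b \<Longrightarrow> 0 < G \<Longrightarrow> (\<And>i. i \<in> S \<Longrightarrow> 0 < y i) \<Longrightarrow> 0 < threshold v k S G b y"
  by (simp add: threshold_def opaque_cost_pos[OF S] min_cost_pos)

lemma min_cost_le: "i \<in> S \<Longrightarrow> min_cost v S y \<le> exp (- v i) * y i"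
  using S by (simp add: min_cost_def)

end

text \<open>The coordinate of the outside option is already integrated out: a standard exponential
  variable exceeds a level x \<ge> 0 with probability exp (-x). The same holds for the two shares
  below, whose indicators tell whether \<open>q\<close> or the best product is preferred; equality
  goes to \<open>q\<close>.\<close>

definition no_purchase :: "(nat \<Rightarrow> real) \<Rightarrow> nat \<Rightarrow> nat set \<Rightarrow> real \<Rightarrow> real \<Rightarrow> real" where
  "no_purchase v k S G b = (\<integral>y. 1 - exp (- threshold v k S G b y) \<partial>PiM S (\<lambda>_. exp1))"

definition opaque_share :: "(nat \<Rightarrow> real) \<Rightarrow> nat \<Rightarrow> nat set \<Rightarrow> real \<Rightarrow> real \<Rightarrow> real" where
  "opaque_share v k S G b = (\<integral>y. exp (- (b * opaque_cost v k S y)) *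
     indicator {y. b * opaque_cost v k S y \<le> G * min_cost v S y} y \<partial>PiM S (\<lambda>_. exp1))"

definition traditional_share :: "(nat \<Rightarrow> real) \<Rightarrow> nat \<Rightarrow> nat set \<Rightarrow> real \<Rightarrow> real \<Rightarrow> real" where
  "traditional_share v k S G b = (\<integral>y. exp (- (G * min_cost v S y)) *
     indicator {y. G * min_cost v S y < b * opaque_cost v k S y} y \<partial>PiM S (\<lambda>_. exp1))"

lemma exp_neg_bounds:
  fixes x d :: real
  assumes "0 \<le> x" "0 \<le> d"
  shows "0 \<le> exp (- x) - exp (- (x + d))" "exp (- x) - exp (- (x + d)) \<le> d"
proof -
  have "exp (- x) - exp (- (x + d)) = exp (- x) * (1 - exp (- d))"
    by (simp add: algebra_simps mult_exp_exp)
  moreover have "exp (- x) \<le> 1" "0 \<le> 1 - exp (- d)" "1 - exp (- d) \<le> d"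
    using assms exp_ge_add_one_self[of "-d"] by auto
  ultimately show "0 \<le> exp (- x) - exp (- (x + d))" "exp (- x) - exp (- (x + d)) \<le> d"
    by (simp_all add: order_trans[OF mult_right_mono[of "exp (-x)" 1]])
qed

lemma exp_difference_quotient: "((\<lambda>t::real. (exp (t * u) - 1) / t) \<longlongrightarrow> u) (at 0)"
proof -
  have "((\<lambda>t. exp (t * u)) has_real_derivative u) (at 0)"
    by (auto intro!: derivative_eq_intros)
  then show ?thesis by (simp add: DERIV_def)
qed

section \<open>Relations between the no-purchase probability and the shares\<close>

context
  fixes S :: "nat set" and k :: nat and v :: "nat \<Rightarrow> real" and b G :: real
  assumes S: "finite S" "S \<noteq> {}" "1 \<le> k" and bG: "0 < b" "b \<le> G"
begin

interpretation P: prob_space "PiM S (\<lambda>_. exp1)" by (rule prob_space_PiM_exp1)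

lemmas [measurable] = borel_measurable_opaque_cost[OF S] borel_measurable_min_cost[OF S]
  borel_measurable_threshold[OF S]

lemma threshold_AE_pos: "AE y in PiM S (\<lambda>_. exp1). 0 < threshold v k S G b y"
  using AE_PiM_exp1_pos[OF S(1)]
  by eventually_elim (use bG in \<open>auto intro!: threshold_pos[OF S]\<close>)

lemma integrable_exp_threshold: "integrable (PiM S (\<lambda>_. exp1)) (\<lambda>y. exp (- threshold v k S G b y))"
  by (rule P.integrable_const_bound[where B=1])
    (use threshold_AE_pos in \<open>auto elim!: eventually_mono\<close>)

lemma no_purchase_eq: "no_purchase v k S G b = 1 - (\<integral>y. exp (- threshold v k S G b y) \<partial>PiM S (\<lambda>_. exp1))"
  unfolding no_purchase_def using integrable_exp_threshold by (simp add: P.prob_space)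

text \<open>For the sum: \<open>threshold\<close> is one of the two scaled costs on the event of the
  first indicator and the other on its complement, so exp (-threshold) splits into the two
  integrands.\<close>

lemma shares:
  "integrable (PiM S (\<lambda>_. exp1)) (\<lambda>y. exp (- (b * opaque_cost v k S y)) *
     indicator {y. b * opaque_cost v k S y \<le> G * min_cost v S y} y)" (is ?i1)
  "integrable (PiM S (\<lambda>_. exp1)) (\<lambda>y. exp (- (G * min_cost v S y)) *
     indicator {y. G * min_cost v S y < b * opaque_cost v k S y} y)" (is ?i2)
  "opaque_share v k S G b + traditional_share v k S G b = 1 - no_purchase v k S G b"
proof -
  show i: ?i1
  proof (rule P.integrable_const_bound[where B=1])
    show "AE y in PiM S (\<lambda>_. exp1). norm (exp (- (b * opaque_cost v k S y)) *
        indicator {y. b * opaque_cost v k S y \<le> G * min_cost v S y} y) \<le> 1"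
      using AE_PiM_exp1_pos[OF S(1)]
    proof eventually_elim
      case (elim y)
      then have "0 \<le> b * opaque_cost v k S y"
        using opaque_cost_pos[OF S, of y v] bG by (intro mult_nonneg_nonneg) auto
      then show ?case by (simp add: indicator_def)
    qed
  qed measurable
  show ii: ?i2
  proof (rule P.integrable_const_bound[where B=1])
    show "AE y in PiM S (\<lambda>_. exp1). norm (exp (- (G * min_cost v S y)) *
        indicator {y. G * min_cost v S y < b * opaque_cost v k S y} y) \<le> 1"
      using AE_PiM_exp1_pos[OF S(1)]
    proof eventually_elim
      case (elim y)
      then have "0 \<le> G * min_cost v S y"
        using min_cost_pos[OF S, of y v] bG by (intro mult_nonneg_nonneg) auto
      then show ?case by (simp add: indicator_def)
    qed
  qed measurable
  show "opaque_share v k S G b + traditional_share v k S G b = 1 - no_purchase v k S G b"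
  proof -
    have "(\<integral>y. exp (- threshold v k S G b y) \<partial>PiM S (\<lambda>_. exp1))
      = (\<integral>y. exp (- (b * opaque_cost v k S y)) *
            indicator {y. b * opaque_cost v k S y \<le> G * min_cost v S y} y +
          exp (- (G * min_cost v S y)) *
            indicator {y. G * min_cost v S y < b * opaque_cost v k S y} y \<partial>PiM S (\<lambda>_. exp1))"
      by (intro Bochner_Integration.integral_cong) (auto simp: threshold_def indicator_def)
    also have "\<dots> = opaque_share v k S G b + traditional_share v k S G b"
      unfolding opaque_share_def traditional_share_def
      by (rule Bochner_Integration.integral_add[OF i ii])
    finally show ?thesis by (simp add: no_purchase_eq)
  qed
qed

text \<open>With f = 1 - exp (- threshold) and w i = exp (v i), memorylessness gives
  E f(y + t w) = exp (t W) E [f(y); y > t w], where W is the sum of the weights. Differentiate at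
  t = 0: the translation raises both costs by t, and the event that some y i is at most t w i
  contributes only O(t^2), since its probability and f on it are O(t).\<close>

lemma share_identity:
  "G * traditional_share v k S G b + b * opaque_share v k S G b
    = (\<Sum>i\<in>S. exp (v i)) * no_purchase v k S G b"
proof -
  let ?P = "PiM S (\<lambda>_. exp1)"
  define \<tau> where "\<tau> = threshold v k S G b"
  define f where "f = (\<lambda>y. 1 - exp (- \<tau> y))"
  define W where "W = (\<Sum>i\<in>S. exp (v i))"
  define sh where "sh = (\<lambda>t y. \<lambda>i\<in>S. y i + t * exp (v i))"
  define pos where "pos = (\<lambda>y::nat \<Rightarrow> real. \<forall>i\<in>S. 0 < y i)"
  define t where "t = (\<lambda>n::nat. 1 / real (Suc n))"
  \<comment> \<open>The right derivative of \<open>\<tau>\<close> along the translation. At a tie it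
    is \<open>b\<close>, because \<open>b \<le> G\<close> keeps the opaque branch minimal.\<close>
  define c where "c = (\<lambda>y. if b * opaque_cost v k S y \<le> G * min_cost v S y then b else G)"
  have [measurable]: "\<tau> \<in> borel_measurable (PiM S (\<lambda>_. borel))" unfolding \<tau>_def by measurable
  have [measurable]: "f \<in> borel_measurable (PiM S (\<lambda>_. borel))" unfolding f_def by measurable
  have [measurable]: "sh u \<in> measurable (PiM S (\<lambda>_. borel)) (PiM S (\<lambda>_. borel))" for u
    unfolding sh_def by measurable
  have [measurable]: "c \<in> borel_measurable (PiM S (\<lambda>_. borel))" unfolding c_def by measurable
  have G: "0 < G" using bG by simp
  have tau_pos: "0 < \<tau> y" if "pos y" for y
    using that bG unfolding pos_def \<tau>_def by (intro threshold_pos[OF S]) auto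
  have oc: "opaque_cost v k S (sh u y) = opaque_cost v k S y + u"
    and mc: "min_cost v S (sh u y) = min_cost v S y + u" for u y
    by (simp_all add: sh_def opaque_cost_shift[OF S] min_cost_shift[OF S])
  have tau: "\<tau> y = min (b * opaque_cost v k S y) (G * min_cost v S y)" for y
    by (simp add: \<tau>_def threshold_def)
  have tau_sh: "\<tau> (sh u y) = min (b * opaque_cost v k S y + b * u) (G * min_cost v S y + G * u)" for u y
    by (simp add: tau oc mc algebra_simps)
  have tau_sh_bounds: "\<tau> y \<le> \<tau> (sh u y)" "\<tau> (sh u y) \<le> \<tau> y + G * u" if "0 \<le> u" for u y
  proof -
    have "0 \<le> b * u" "b * u \<le> G * u" using that bG mult_right_mono[of b G u] by auto
    then show "\<tau> y \<le> \<tau> (sh u y)" "\<tau> (sh u y) \<le> \<tau> y + G * u"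
      unfolding tau_sh tau[of y] by (auto simp: min_def)
  qed
  have AE_pos: "AE y in ?P. pos y" using AE_PiM_exp1_pos[OF S(1)] by (simp add: pos_def)
  have pos_sh: "pos (sh u y)" if "pos y" "0 \<le> u" for u y
    using that by (auto simp: pos_def sh_def intro!: add_pos_nonneg)
  have f_bounds: "0 \<le> f y" "f y \<le> 1" if "pos y" for y
    using tau_pos[OF that] by (auto simp: f_def)
  have f_diff: "0 \<le> f (sh u y) - f y" "f (sh u y) - f y \<le> G * u" if "pos y" "0 \<le> u" for u y
    using exp_neg_bounds[of "\<tau> y" "\<tau> (sh u y) - \<tau> y"] tau_pos[OF that(1)] tau_sh_bounds[OF that(2), of y]
    by (auto simp: f_def)
  have int_f: "integrable ?P f"
    by (rule P.integrable_const_bound[where B=1]) (use AE_pos f_bounds in \<open>auto elim!: eventually_mono\<close>)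
  have int_fs: "integrable ?P (\<lambda>y. f (sh u y))" if "0 \<le> u" for u
    by (rule P.integrable_const_bound[where B=1])
      (use AE_pos f_bounds pos_sh that in \<open>auto elim!: eventually_mono\<close>)
  define ind where "ind = (\<lambda>u. indicator {y::nat\<Rightarrow>real. \<forall>i\<in>S. u * exp (v i) < y i} :: _ \<Rightarrow> real)"
  have [measurable]: "ind u \<in> borel_measurable (PiM S (\<lambda>_. borel))" for u
    unfolding ind_def using S(1) by measurable
  \<comment> \<open>Memorylessness for real integrals, where nonnegativity of \<open>g\<close> on
    \<open>pos\<close> justifies the passage through nonnegative integrals. It is applied to
    \<open>f\<close> and to the constant 1.\<close>
  have shift: "(\<integral>y. g (sh u y) \<partial>?P) = exp (u * W) * (\<integral>y. g y * ind u y \<partial>?P)"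
    if [measurable]: "g \<in> borel_measurable (PiM S (\<lambda>_. borel))" and g: "\<And>y. pos y \<Longrightarrow> 0 \<le> g y" and u: "0 \<le> u"
    for g u
  proof -
    have "(\<integral>\<^sup>+y. ennreal (g (sh u y)) \<partial>?P)
      = ennreal (exp (u * W)) * (\<integral>\<^sup>+y. ennreal (g y * ind u y) \<partial>?P)"
      using nn_integral_PiM_exp1_memoryless[OF S(1), of "\<lambda>i. u * exp (v i)" "\<lambda>y. ennreal (g y)"] u
      by (simp add: sh_def W_def sum_distrib_left ind_def ennreal_mult'' flip: ennreal_indicator)
    then show ?thesis
      using u by (subst (1 2) integral_eq_nn_integral)
        (use AE_pos g pos_sh in \<open>auto elim!: eventually_mono simp: ind_def enn2real_mult indicator_def\<close>)
  qed
  have t: "0 < t n" for n by (simp add: t_def)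
  have t_lim: "t \<longlonglongrightarrow> 0" unfolding t_def by (rule LIMSEQ_Suc[OF lim_1_over_n])
  have t_at: "filterlim t (at 0) sequentially"
    using t t_lim by (auto simp: filterlim_at less_imp_neq intro!: always_eventually) (metis less_irrefl)
  have exp_lim: "(\<lambda>n. (exp (t n * u) - 1) / t n) \<longlonglongrightarrow> u" for u
    by (rule filterlim_compose[OF exp_difference_quotient t_at])
  define g where "g = (\<lambda>n y. (f (sh (t n) y) - f y) / t n)"
  have lim1: "(\<lambda>n. \<integral>y. g n y \<partial>?P) \<longlonglongrightarrow> (\<integral>y. exp (- \<tau> y) * c y \<partial>?P)"
  \<comment> \<open>\<open>G\<close> dominates the quotients: \<open>\<tau>\<close> grows at rate at
    most \<open>G\<close>, and 1 - exp (-x) is 1-Lipschitz on x \<ge> 0.\<close>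
  proof (rule integral_dominated_convergence[where w="\<lambda>_. G"])
    show "AE y in ?P. (\<lambda>n. g n y) \<longlonglongrightarrow> exp (- \<tau> y) * c y"
    proof (intro AE_I2)
      fix y
      have "eventually (\<lambda>n. \<tau> (sh (t n) y) = \<tau> y + c y * t n) sequentially"
      proof (cases "b * opaque_cost v k S y \<le> G * min_cost v S y")
        case True
        then have "\<tau> (sh u y) = \<tau> y + c y * u" if "0 \<le> u" for u
          unfolding tau_sh tau[of y] c_def using mult_right_mono[OF bG(2) that] by (auto simp: min_def)
        then show ?thesis using t by (auto intro!: always_eventually less_imp_le)
      next
        case False
        \<comment> \<open>The traditional branch is strictly smaller here and stays the minimum
          until its faster growth has closed the gap.\<close>
        have "(\<lambda>n. (G - b) * t n) \<longlonglongrightarrow> (G - b) * 0"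
          by (intro tendsto_mult tendsto_const t_lim)
        then have "eventually (\<lambda>n. (G - b) * t n < b * opaque_cost v k S y - G * min_cost v S y) sequentially"
          using False by (intro order_tendstoD(2)) auto
        then show ?thesis
          by eventually_elim (use False in \<open>auto simp: tau_sh tau[of y] c_def algebra_simps min_def\<close>)
      qed
      then have "eventually (\<lambda>n. exp (- \<tau> y) * ((1 - exp (- (c y * t n))) / t n) = g n y) sequentially"
      proof eventually_elim
        case (elim n)
        have "exp (- (\<tau> y + c y * t n)) = exp (- \<tau> y) * exp (- (c y * t n))"
          by (simp add: mult_exp_exp)
        with elim show ?case
          by (simp add: g_def f_def right_diff_distrib diff_divide_distrib)
      qed
      moreover have "(\<lambda>n. (1 - exp (- (c y * t n))) / t n) \<longlonglongrightarrow> c y"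
        using tendsto_minus[OF exp_lim[of "- c y"]] by (simp add: minus_divide_left mult.commute)
      ultimately show "(\<lambda>n. g n y) \<longlonglongrightarrow> exp (- \<tau> y) * c y"
        by (intro Lim_transform_eventually[OF tendsto_mult[OF tendsto_const]])
    qed
    show "AE y in ?P. norm (g n y) \<le> G" for n
      using AE_pos
    proof eventually_elim
      case (elim y)
      then have "0 \<le> f (sh (t n) y) - f y" "f (sh (t n) y) - f y \<le> G * t n"
        using f_diff[of y "t n"] t[of n] by auto
      then show ?case using t[of n] by (simp add: g_def divide_le_eq)
    qed
  qed (use G in \<open>auto simp: g_def\<close>)
  have lim2: "(\<lambda>n. \<integral>y. g n y \<partial>?P) \<longlonglongrightarrow> W * (\<integral>y. f y \<partial>?P)"
  proof -
    define F where "F = (\<integral>y. f y \<partial>?P)"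
    \<comment> \<open>The quotient subtracted here is the one that would result if no mass were lost
      to small coordinates. The difference is -exp (t W) E / t, where \<open>E\<close> integrates
      \<open>f\<close> over the vectors with some too small coordinate.\<close>
    have bound: "\<bar>(\<integral>y. g n y \<partial>?P) - (exp (t n * W) - 1) / t n * F\<bar> \<le> G * (exp (t n * W) - 1)" for n
    proof -
      define E where "E = (\<integral>y. f y * (1 - ind (t n) y) \<partial>?P)"
      have ib: "0 \<le> ind (t n) y" "ind (t n) y \<le> 1" for y by (auto simp: ind_def)
      have if1: "integrable ?P (\<lambda>y. f y * ind (t n) y)"
        by (rule P.integrable_const_bound[where B=1])
          (use AE_pos f_bounds in \<open>auto elim!: eventually_mono simp: ind_def indicator_def\<close>)
      have if2: "integrable ?P (ind (t n))"
        by (rule P.integrable_const_bound[where B=1]) (auto simp: ind_def indicator_def)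
      have E: "E = F - (\<integral>y. f y * ind (t n) y \<partial>?P)"
        unfolding E_def F_def using int_f if1 by (simp add: algebra_simps)
      have "(\<integral>y. f (sh (t n) y) \<partial>?P) = exp (t n * W) * (F - E)"
        using shift[of f "t n"] f_bounds t[of n] E by simp
      then have "(\<integral>y. g n y \<partial>?P) = (exp (t n * W) * (F - E) - F) / t n"
        unfolding g_def using int_f int_fs[of "t n"] t[of n] by (simp add: F_def)
      moreover have "(x * (F - E) - F) / s - (x - 1) / s * F = - (x * E / s)" for x s
        by (cases "s = 0") (simp_all add: field_simps)
      ultimately have eq: "(\<integral>y. g n y \<partial>?P) - (exp (t n * W) - 1) / t n * F = - (exp (t n * W) * E / t n)"
        by (simp only:)
      have E0: "0 \<le> E" unfolding E_def
        by (rule integral_nonneg_AE) (use AE_pos f_bounds ib in \<open>auto elim!: eventually_mono\<close>)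
      \<comment> \<open>So all coordinates are large with probability exp (-t W), and the complement
        has probability 1 - exp (-t W), which is of order \<open>t\<close>.\<close>
      have ind1: "exp (t n * W) * (\<integral>y. ind (t n) y \<partial>?P) = 1"
        using shift[of "\<lambda>_. 1" "t n"] t[of n] by (simp add: P.prob_space)
      have "E \<le> (\<integral>y. G * t n * (1 - ind (t n) y) \<partial>?P)"
        unfolding E_def
      proof (rule integral_mono_AE)
        show "AE y in ?P. f y * (1 - ind (t n) y) \<le> G * t n * (1 - ind (t n) y)"
          using AE_pos
        proof eventually_elim
          case (elim y)
          show ?case
          proof (cases "ind (t n) y = 1")
            case False
            \<comment> \<open>The failing coordinate \<open>i\<close> has cost at most
              \<open>t n\<close>. This bounds the least cost, and with it \<open>\<tau>\<close> and
              \<open>f\<close> by \<open>G * t n\<close>.\<close>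
            then obtain i where i: "i \<in> S" "y i \<le> t n * exp (v i)"
              by (auto simp: ind_def indicator_def not_less split: if_splits)
            have "min_cost v S y \<le> exp (- v i) * y i" by (rule min_cost_le[OF S i(1)])
            also have "\<dots> \<le> exp (- v i) * (t n * exp (v i))" using i by (intro mult_left_mono) auto
            also have "\<dots> = t n" by (simp add: exp_minus)
            finally have "\<tau> y \<le> G * t n" unfolding tau using G by (simp add: min_le_iff_disj)
            then have "f y \<le> G * t n" using exp_ge_add_one_self[of "- \<tau> y"] by (simp add: f_def)
            then show ?thesis using ib by (intro mult_right_mono) auto
          qed simp
        qed
      qed (use int_f if1 if2 in \<open>auto simp: algebra_simps\<close>)
      also have "\<dots> = G * t n * (1 - (\<integral>y. ind (t n) y \<partial>?P))"
        using if2 by (simp add: P.prob_space)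
      finally have "exp (t n * W) * E \<le> exp (t n * W) * (G * t n * (1 - (\<integral>y. ind (t n) y \<partial>?P)))"
        by (intro mult_left_mono) auto
      also have "\<dots> = G * t n * (exp (t n * W) - exp (t n * W) * (\<integral>y. ind (t n) y \<partial>?P))"
        by (simp add: algebra_simps)
      finally have "exp (t n * W) * E / t n \<le> G * (exp (t n * W) - 1)"
        unfolding ind1 using t[of n] by (simp add: field_simps)
      then show ?thesis unfolding eq using E0 t[of n] by simp
    qed
    have "(\<lambda>n. G * (exp (t n * W) - 1)) \<longlonglongrightarrow> G * (exp (0 * W) - 1)"
      by (intro tendsto_intros t_lim)
    then have lim0: "(\<lambda>n. G * (exp (t n * W) - 1)) \<longlonglongrightarrow> 0" by simp
    have "(\<lambda>n. (\<integral>y. g n y \<partial>?P) - (exp (t n * W) - 1) / t n * F) \<longlonglongrightarrow> 0"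
      by (rule Lim_null_comparison[OF _ lim0])
        (unfold real_norm_def, intro always_eventually allI bound)
    moreover have "(\<lambda>n. (exp (t n * W) - 1) / t n * F) \<longlonglongrightarrow> W * F"
      by (intro tendsto_mult tendsto_const exp_lim)
    ultimately have "(\<lambda>n. (\<integral>y. g n y \<partial>?P) - (exp (t n * W) - 1) / t n * F + (exp (t n * W) - 1) / t n * F)
       \<longlonglongrightarrow> 0 + W * F"
      by (rule tendsto_add)
    then show ?thesis by (simp add: F_def)
  qed
  have "(\<integral>y. exp (- \<tau> y) * c y \<partial>?P) = W * (\<integral>y. f y \<partial>?P)"
    by (rule LIMSEQ_unique[OF lim1 lim2])
  \<comment> \<open>Pointwise, \<open>\<tau>\<close> is the scaled cost of the preferred option and
    \<open>c\<close> its scale factor, so the integrand separates into the two shares.\<close>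
  also have "(\<integral>y. exp (- \<tau> y) * c y \<partial>?P)
      = (\<integral>y. G * (exp (- (G * min_cost v S y)) *
            indicator {y. G * min_cost v S y < b * opaque_cost v k S y} y) +
          b * (exp (- (b * opaque_cost v k S y)) *
            indicator {y. b * opaque_cost v k S y \<le> G * min_cost v S y} y) \<partial>?P)"
    by (intro Bochner_Integration.integral_cong) (auto simp: tau c_def indicator_def)
  also have "\<dots> = G * traditional_share v k S G b + b * opaque_share v k S G b"
    unfolding opaque_share_def traditional_share_def
    using shares(1,2) by (subst Bochner_Integration.integral_add) (auto simp del: indicator_simps)
  finally show ?thesis by (simp add: W_def no_purchase_def f_def \<tau>_def)
qed

end

section \<open>From Gumbel valuations to exponential coordinates\<close>

lemma emeasure_exp1_atLeast:
  assumes "0 \<le> c"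
  shows "emeasure exp1 {c..} = ennreal (exp (- c))" "emeasure exp1 {c<..} = ennreal (exp (- c))"
proof -
  have "distributed exp1 lborel (\<lambda>x. x) (exponential_density 1)"
    by (auto simp: distributed_def exp1_def distr_id[unfolded id_def] cong: distr_cong intro!: distr_id2)
  from exp1.exponential_distributedD_gt[OF this assms]
  have "measure exp1 {c<..} = exp (- c)"
    by (simp add: greaterThan_def)
  then show gt: "emeasure exp1 {c<..} = ennreal (exp (- c))"
    by (simp add: exp1.emeasure_eq_measure)
  have "AE y in exp1. y \<noteq> c"
    unfolding exp1_def by (subst AE_density) (use AE_lborel_singleton[of c] in \<open>auto elim!: eventually_mono\<close>)
  then have "emeasure exp1 {c..} = emeasure exp1 {c<..}"
    by (intro emeasure_eq_AE) (auto elim!: eventually_mono)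
  with gt show "emeasure exp1 {c..} = ennreal (exp (- c))" by simp
qed

text \<open>For a > 0, exp (-X) \<le> a means X \<ge> -ln a, a closed upper ray, while the
  hypothesis gives the distribution function. Continuity of the latter rules out an atom at -ln a,
  and its value there is exp (-a).\<close>

lemma (in prob_space) gumbel_imp_exp1:
  assumes "gumbel_distributed M X"
  shows "distr M borel (\<lambda>\<omega>. exp (- X \<omega>)) = exp1"
proof -
  have [measurable]: "X \<in> borel_measurable M" using assms by (simp add: gumbel_distributed_def)
  interpret D: real_distribution "distr M borel X" by (rule real_distribution_distr) measurable
  have cdf: "cdf (distr M borel X) = (\<lambda>x. exp (- exp (- x)))"
    using assms by (auto simp: cdf_def measure_distr gumbel_distributed_def vimage_def Int_def conj_commute)
  have "isCont (cdf (distr M borel X)) x" for x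
    unfolding cdf by (intro continuous_intros)
  then have sing: "measure (distr M borel X) {x} = 0" for x
    by (simp add: D.isCont_cdf)
  have "distributed M lborel (\<lambda>\<omega>. exp (- X \<omega>)) (exponential_density 1)"
  proof (subst exponential_distributed_iff, simp, intro conjI allI impI)
    fix a :: real assume "0 \<le> a"
    show "prob {\<omega> \<in> space M. exp (- X \<omega>) \<le> a} = 1 - exp (- a * 1)"
    proof (cases "a = 0")
      case False
      with \<open>0 \<le> a\<close> have a: "0 < a" by simp
      have "prob {\<omega> \<in> space M. exp (- X \<omega>) \<le> a} = measure (distr M borel X) {- ln a..}"
        using a by (subst measure_distr) (auto intro!: arg_cong[where f=prob] simp: ln_ge_iff[symmetric]
            minus_le_iff ln_le_cancel_iff[symmetric] simp del: ln_le_cancel_iff)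
      also have "{- ln a..} = UNIV - ({.. - ln a} - {- ln a})" by auto
      also have "measure (distr M borel X) (UNIV - ({.. - ln a} - {- ln a}))
          = 1 - measure (distr M borel X) ({.. - ln a} - {- ln a})"
        using D.prob_compl[of "{.. - ln a} - {- ln a}"] by simp
      also have "measure (distr M borel X) ({.. - ln a} - {- ln a}) = cdf (distr M borel X) (- ln a)"
        by (subst D.finite_measure_Diff) (auto simp: sing cdf_def)
      finally show ?thesis using a by (simp add: cdf)
    qed simp
  qed measurable
  then show ?thesis
    by (simp add: distributed_def exp1_def cong: distr_cong)
qed

locale gumbel_market = prob_space M for M :: "'a measure" +
  fixes \<epsilon> :: "nat \<Rightarrow> 'a \<Rightarrow> real" and n :: nat
  assumes iid: "iid_gumbel M {0..n} \<epsilon>"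
begin

lemma eps_measurable [measurable]: "i \<le> n \<Longrightarrow> \<epsilon> i \<in> borel_measurable M"
  using iid by (auto simp: iid_gumbel_def gumbel_distributed_def)

lemma distr_exp_eps:
  assumes "I \<noteq> {}" "I \<subseteq> {0..n}"
  shows "distr M (PiM I (\<lambda>_. borel)) (\<lambda>\<omega>. \<lambda>i\<in>I. exp (- \<epsilon> i \<omega>)) = PiM I (\<lambda>_. exp1)"
proof -
  have "indep_vars (\<lambda>_. borel) \<epsilon> I"
    using iid by (intro indep_vars_subset[OF _ assms(2)]) (simp add: iid_gumbel_def)
  then have "indep_vars (\<lambda>_. borel) (\<lambda>i \<omega>. exp (- \<epsilon> i \<omega>)) I"
    by (rule indep_vars_compose2) measurable
  then have "distr M (PiM I (\<lambda>_. borel)) (\<lambda>\<omega>. \<lambda>i\<in>I. exp (- \<epsilon> i \<omega>))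
    = PiM I (\<lambda>i. distr M borel (\<lambda>\<omega>. exp (- \<epsilon> i \<omega>)))"
    by (subst (asm) indep_vars_iff_distr_eq_PiM') (use assms in auto)
  also have "\<dots> = PiM I (\<lambda>_. exp1)"
    using iid assms by (intro PiM_cong gumbel_imp_exp1) (auto simp: iid_gumbel_def)
  finally show ?thesis .
qed

text \<open>Given the coordinates in \<open>I\<close>, the independent exponential coordinate
  \<open>z\<close> exceeds the level \<open>h\<close> with probability exp (-h). The weak version
  fits \<open>q\<close>, which wins ties, the strict one the products; their equality also makes
  ties null events.\<close>

lemma prob_threshold:
  fixes h :: "(nat \<Rightarrow> real) \<Rightarrow> real"
  assumes I: "finite I" "z \<notin> I" "insert z I \<subseteq> {0..n}"
    and [measurable]: "h \<in> borel_measurable (PiM I (\<lambda>_. borel))" "Measurable.pred (PiM I (\<lambda>_. borel)) R"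
    and h: "AE y in PiM I (\<lambda>_. exp1). R y \<longrightarrow> 0 \<le> h y"
  shows "prob {\<omega> \<in> space M. h (\<lambda>i\<in>I. exp (- \<epsilon> i \<omega>)) \<le> exp (- \<epsilon> z \<omega>) \<and> R (\<lambda>i\<in>I. exp (- \<epsilon> i \<omega>))}
      = (\<integral>y. exp (- h y) * indicator {y. R y} y \<partial>PiM I (\<lambda>_. exp1))" (is "?le = ?I")
    and "prob {\<omega> \<in> space M. h (\<lambda>i\<in>I. exp (- \<epsilon> i \<omega>)) < exp (- \<epsilon> z \<omega>) \<and> R (\<lambda>i\<in>I. exp (- \<epsilon> i \<omega>))}
      = (\<integral>y. exp (- h y) * indicator {y. R y} y \<partial>PiM I (\<lambda>_. exp1))" (is "?less = ?I")
proof -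
  \<comment> \<open>\<open>C\<close> is the closed or the open ray; both have the same exponential
    measure, so one computation covers both versions.\<close>
  have main: "prob {\<omega> \<in> space M. exp (- \<epsilon> z \<omega>) \<in> C (h (\<lambda>i\<in>I. exp (- \<epsilon> i \<omega>))) \<and> R (\<lambda>i\<in>I. exp (- \<epsilon> i \<omega>))} = ?I"
    if C: "C = (\<lambda>c. {c..}) \<or> C = (\<lambda>c. {c<..})" for C :: "real \<Rightarrow> real set"
  proof -
    let ?Q = "\<lambda>y. y z \<in> C (h (\<lambda>i\<in>I. y i)) \<and> R (\<lambda>i\<in>I. y i)"
    let ?J = "insert z I"
    have [measurable]: "(\<lambda>y. y z) \<in> borel_measurable (PiM ?J (\<lambda>_. borel))" by measurable
    have [measurable]: "(\<lambda>y. \<lambda>i\<in>I. y i) \<in> measurable (PiM ?J (\<lambda>_. borel)) (PiM I (\<lambda>_. borel))"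
      by (intro measurable_restrict) auto
    have [measurable]: "(\<lambda>y. h (\<lambda>i\<in>I. y i)) \<in> borel_measurable (PiM ?J (\<lambda>_. borel))"
      "Measurable.pred (PiM ?J (\<lambda>_. borel)) (\<lambda>y. R (\<lambda>i\<in>I. y i))"
      by measurable
    have [measurable]: "Measurable.pred (PiM ?J (\<lambda>_. borel)) (\<lambda>y. y z \<in> C (h (\<lambda>i\<in>I. y i)))"
      using C by (elim disjE) simp_all
    have [measurable]: "Measurable.pred (PiM ?J (\<lambda>_. borel)) ?Q"
      by measurable
    have [measurable]: "(\<lambda>\<omega>. \<lambda>i\<in>?J. exp (- \<epsilon> i \<omega>)) \<in> measurable M (PiM ?J (\<lambda>_. borel))"
      using I by (intro measurable_restrict) auto
    have upd: "(\<lambda>i\<in>I. (x(z := y)) i) = x" if "x \<in> space (PiM I (\<lambda>_. exp1))" for x y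
      using that I by (auto simp: space_PiM PiE_def extensional_def fun_eq_iff)
    have Cb: "C c \<in> sets borel" for c using C by auto
    have emC: "emeasure exp1 (C c) = ennreal (exp (- c))" if "0 \<le> c" for c
      using C emeasure_exp1_atLeast[OF that] by auto
    have "emeasure M {\<omega> \<in> space M. exp (- \<epsilon> z \<omega>) \<in> C (h (\<lambda>i\<in>I. exp (- \<epsilon> i \<omega>))) \<and> R (\<lambda>i\<in>I. exp (- \<epsilon> i \<omega>))}
        = emeasure (distr M (PiM ?J (\<lambda>_. borel)) (\<lambda>\<omega>. \<lambda>i\<in>?J. exp (- \<epsilon> i \<omega>)))
            {y \<in> space (PiM ?J (\<lambda>_. borel)). ?Q y}"
    proof (subst emeasure_distr)
      have "?J \<inter> I = I" by auto
      then show "emeasure M {\<omega> \<in> space M. exp (- \<epsilon> z \<omega>) \<in> C (h (\<lambda>i\<in>I. exp (- \<epsilon> i \<omega>))) \<and> R (\<lambda>i\<in>I. exp (- \<epsilon> i \<omega>))}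
        = emeasure M ((\<lambda>\<omega>. \<lambda>i\<in>?J. exp (- \<epsilon> i \<omega>)) -` {y \<in> space (PiM ?J (\<lambda>_. borel)). ?Q y} \<inter> space M)"
        by (intro arg_cong[where f="emeasure M"]) (auto simp: space_PiM)
    qed measurable
    also have "\<dots> = emeasure (PiM ?J (\<lambda>_. exp1)) {y \<in> space (PiM ?J (\<lambda>_. exp1)). ?Q y}"
      using I by (subst distr_exp_eps) (auto simp: space_PiM)
    also have "\<dots> = (\<integral>\<^sup>+y. indicator {y. ?Q y} y \<partial>PiM ?J (\<lambda>_. exp1))"
    proof -
      have "(\<integral>\<^sup>+y. indicator {y. ?Q y} y \<partial>PiM ?J (\<lambda>_. exp1))
          = (\<integral>\<^sup>+y. indicator {y \<in> space (PiM ?J (\<lambda>_. exp1)). ?Q y} y \<partial>PiM ?J (\<lambda>_. exp1))"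
        by (rule nn_integral_cong) (simp add: indicator_def)
      also have "\<dots> = emeasure (PiM ?J (\<lambda>_. exp1)) {y \<in> space (PiM ?J (\<lambda>_. exp1)). ?Q y}"
        by (rule nn_integral_indicator) measurable
      finally show ?thesis ..
    qed
    also have "\<dots> = (\<integral>\<^sup>+x. \<integral>\<^sup>+y. indicator {y. ?Q y} (x(z := y)) \<partial>exp1 \<partial>PiM I (\<lambda>_. exp1))"
      using I by (intro exp1_PiM.product_nn_integral_insert) auto
    also have "\<dots> = (\<integral>\<^sup>+x. ennreal (exp (- h x) * indicator {y. R y} x) \<partial>PiM I (\<lambda>_. exp1))"
    proof (intro nn_integral_cong_AE)
      show "AE x in PiM I (\<lambda>_. exp1). (\<integral>\<^sup>+y. indicator {y. ?Q y} (x(z := y)) \<partial>exp1)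
        = ennreal (exp (- h x) * indicator {y. R y} x)"
        using h AE_space
      proof eventually_elim
        case (elim x)
        have "(\<integral>\<^sup>+y. indicator {y. ?Q y} (x(z := y)) \<partial>exp1)
          = (\<integral>\<^sup>+y. indicator (C (h x)) y * indicator {y. R y} x \<partial>exp1)"
          using I upd[OF elim(2)] elim(2)
          by (intro nn_integral_cong) (auto simp: indicator_def space_PiM PiE_restrict)
        also have "\<dots> = emeasure exp1 (C (h x)) * indicator {y. R y} x"
          using Cb by (subst nn_integral_multc) (auto intro!: borel_measurable_indicator)
        also have "\<dots> = ennreal (exp (- h x) * indicator {y. R y} x)"
          using elim(1) by (auto simp: indicator_def emC)
        finally show ?case .
      qed
    qed
    finally have "emeasure M {\<omega> \<in> space M. exp (- \<epsilon> z \<omega>) \<in> C (h (\<lambda>i\<in>I. exp (- \<epsilon> i \<omega>))) \<and> R (\<lambda>i\<in>I. exp (- \<epsilon> i \<omega>))}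
      = (\<integral>\<^sup>+x. ennreal (exp (- h x) * indicator {y. R y} x) \<partial>PiM I (\<lambda>_. exp1))" .
    then show ?thesis
      by (subst integral_eq_nn_integral) (auto simp: measure_def)
  qed
  show "?le = ?I" using main[of "\<lambda>c. {c..}"] by simp
  show "?less = ?I" using main[of "\<lambda>c. {c<..}"] by simp
qed

text \<open>The weak and the strict version of \<open>prob_threshold\<close>, with \<open>i\<close>
  as the conditioning coordinate and \<open>j\<close> as the free one, have equal probability, and
  the tie is their difference.\<close>

lemma AE_no_tie:
  assumes "i \<le> n" "j \<le> n" "i \<noteq> j"
  shows "AE \<omega> in M. c + \<epsilon> i \<omega> \<noteq> \<epsilon> j \<omega>"
proof -
  let ?h = "\<lambda>y. exp (- c) * y i"
  let ?le = "{\<omega> \<in> space M. exp (- c) * exp (- \<epsilon> i \<omega>) \<le> exp (- \<epsilon> j \<omega>)}"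
  let ?less = "{\<omega> \<in> space M. exp (- c) * exp (- \<epsilon> i \<omega>) < exp (- \<epsilon> j \<omega>)}"
  have [measurable]: "\<epsilon> i \<in> borel_measurable M" "\<epsilon> j \<in> borel_measurable M" using assms by auto
  have h: "AE y in PiM {i} (\<lambda>_. exp1). True \<longrightarrow> 0 \<le> ?h y"
    using AE_PiM_exp1_pos[of "{i}"] by (auto elim!: eventually_mono)
  have [measurable]: "?h \<in> borel_measurable (PiM {i} (\<lambda>_. borel))" by measurable
  have "prob ?le = prob ?less"
    using prob_threshold[of "{i}" j ?h "\<lambda>_. True", OF _ _ _ _ _ h] assms by simp
  then have "prob (?le - ?less) = 0"
    by (subst finite_measure_Diff) auto
  then have "AE \<omega> in M. \<omega> \<notin> ?le - ?less"
    by (intro AE_I[where N="?le - ?less"]) (auto simp: emeasure_eq_measure)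
  then show ?thesis
    using AE_space by eventually_elim (auto simp: mult_exp_exp)
qed

end

section \<open>Market choice probabilities as integrals over exponential coordinates\<close>

context gumbel_market
begin

context
  fixes S :: "nat set" and k :: nat and v p :: "nat \<Rightarrow> real" and r \<rho> :: real
  assumes S: "S \<subseteq> {1..n}" "S \<noteq> {}" and k: "1 \<le> k" and p: "\<And>i. i \<in> S \<Longrightarrow> p i = r"
begin

lemma finS: "finite S" using S finite_subset by blast
lemma zero_notin: "0 \<notin> S" using S by auto

lemma valuation_measurable [measurable]:
  "i \<in> insert 0 S \<Longrightarrow> (\<lambda>\<omega>. valuation v \<epsilon> \<omega> i) \<in> borel_measurable M"
  using S by (cases "i = 0") (auto simp: valuation_def)

lemma exp_valuation: "i \<in> S \<Longrightarrow> exp (- valuation v \<epsilon> \<omega> i) = exp (- v i) * exp (- \<epsilon> i \<omega>)"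
  using zero_notin by (auto simp: valuation_def mult_exp_exp)

lemma opaque_cost_exp_eps:
  "opaque_cost v k S (\<lambda>i\<in>S. exp (- \<epsilon> i \<omega>)) = exp (- opaque_valuation k S (valuation v \<epsilon> \<omega>))"
proof -
  have "opaque_cost v k S (\<lambda>i\<in>S. exp (- \<epsilon> i \<omega>))
      = - opaque_valuation k S (\<lambda>i. - exp (- valuation v \<epsilon> \<omega> i))"
    unfolding opaque_cost_def
    by (intro arg_cong[where f=uminus] opaque_valuation_cong finS) (simp add: exp_valuation)
  also have "\<dots> = exp (- opaque_valuation k S (valuation v \<epsilon> \<omega>))"
    by (subst opaque_valuation_strict_mono[OF finS S(2) k, of "\<lambda>z. - exp (- z)"])
      (auto simp: strict_mono_def)
  finally show ?thesis .
qed

lemma min_cost_exp_eps: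
  "min_cost v S (\<lambda>i\<in>S. exp (- \<epsilon> i \<omega>)) = Min ((\<lambda>i. exp (- valuation v \<epsilon> \<omega> i)) ` S)"
  unfolding min_cost_def by (intro arg_cong[where f=Min] image_cong) (auto simp: exp_valuation)

lemma chooses_opaque_iff:
  "chooses_opaque k S p \<rho> (valuation v \<epsilon> \<omega>) \<longleftrightarrow>
    exp \<rho> * opaque_cost v k S (\<lambda>i\<in>S. exp (- \<epsilon> i \<omega>)) \<le> exp (- \<epsilon> 0 \<omega>) \<and>
    exp \<rho> * opaque_cost v k S (\<lambda>i\<in>S. exp (- \<epsilon> i \<omega>)) \<le> exp r * min_cost v S (\<lambda>i\<in>S. exp (- \<epsilon> i \<omega>))"
proof -
  let ?V = "valuation v \<epsilon> \<omega>"
  have zero: "utility p ?V 0 \<le> opaque_utility k S \<rho> ?V \<longleftrightarrow>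
      exp \<rho> * opaque_cost v k S (\<lambda>i\<in>S. exp (- \<epsilon> i \<omega>)) \<le> exp (- \<epsilon> 0 \<omega>)"
    by (auto simp: utility_def opaque_utility_def opaque_cost_exp_eps valuation_def mult_exp_exp)
  have "exp \<rho> * opaque_cost v k S (\<lambda>i\<in>S. exp (- \<epsilon> i \<omega>)) \<le> exp r * min_cost v S (\<lambda>i\<in>S. exp (- \<epsilon> i \<omega>))
      \<longleftrightarrow> exp (\<rho> - opaque_valuation k S ?V - r) \<le> Min ((\<lambda>i. exp (- ?V i)) ` S)"
  proof -
    have "exp \<rho> * exp (- opaque_valuation k S ?V) = exp r * exp (\<rho> - opaque_valuation k S ?V - r)"
      by (simp add: mult_exp_exp)
    then show ?thesis unfolding opaque_cost_exp_eps min_cost_exp_eps by (simp only:) simp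
  qed
  also have "\<dots> \<longleftrightarrow> (\<forall>i\<in>S. exp (\<rho> - opaque_valuation k S ?V - r) \<le> exp (- ?V i))"
    using finS S by (subst Min_ge_iff) auto
  also have "\<dots> \<longleftrightarrow> (\<forall>i\<in>S. utility p ?V i \<le> opaque_utility k S \<rho> ?V)"
    using zero_notin p by (intro ball_cong refl) (auto simp: utility_def opaque_utility_def)
  finally show ?thesis using zero by (auto simp: chooses_opaque_def)
qed

text \<open>At a common price the product of least cost is the only candidate, so it suffices that
  it beats \<open>0\<close> and \<open>q\<close>. Distinct valuations make it beat the other
  products strictly, as \<open>chooses_product\<close> demands.\<close>

lemma chooses_product_Ex_iff:
  assumes "\<And>i j. i \<in> S \<Longrightarrow> j \<in> S \<Longrightarrow> i \<noteq> j \<Longrightarrow> valuation v \<epsilon> \<omega> i \<noteq> valuation v \<epsilon> \<omega> j"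
  shows "(\<exists>i\<in>S. chooses_product k S p \<rho> (valuation v \<epsilon> \<omega>) i) \<longleftrightarrow>
    exp r * min_cost v S (\<lambda>i\<in>S. exp (- \<epsilon> i \<omega>)) < exp (- \<epsilon> 0 \<omega>) \<and>
    exp r * min_cost v S (\<lambda>i\<in>S. exp (- \<epsilon> i \<omega>)) < exp \<rho> * opaque_cost v k S (\<lambda>i\<in>S. exp (- \<epsilon> i \<omega>))"
    (is "?L \<longleftrightarrow> ?R")
proof -
  let ?V = "valuation v \<epsilon> \<omega>"
  define A where "A = min_cost v S (\<lambda>i\<in>S. exp (- \<epsilon> i \<omega>))"
  have A_le: "A \<le> exp (- ?V i)" if "i \<in> S" for i
    unfolding A_def min_cost_exp_eps using finS that by auto
  have "A \<in> (\<lambda>i. exp (- ?V i)) ` S"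
    unfolding A_def min_cost_exp_eps using finS S by (intro Min_in) auto
  then obtain m where m: "m \<in> S" "A = exp (- ?V m)" by auto
  have R: "?R \<longleftrightarrow> ?V 0 < ?V m - r \<and> opaque_valuation k S ?V - \<rho> < ?V m - r"
    unfolding A_def[symmetric] m(2) opaque_cost_exp_eps by (auto simp: mult_exp_exp valuation_def)
  have u: "utility p ?V i = ?V i - r" if "i \<in> S" for i
    using that zero_notin p by (auto simp: utility_def)
  have u0: "utility p ?V 0 = ?V 0" by (simp add: utility_def)
  show ?thesis
  proof
    assume ?L
    then obtain i where i: "i \<in> S" "chooses_product k S p \<rho> ?V i" by auto
    have "?V i \<le> ?V m" using A_le[OF i(1)] m by simp
    moreover have "i \<noteq> 0" using i zero_notin by metis
    then have "0 \<in> insert 0 S - {i}" by simp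
    then have "utility p ?V 0 < utility p ?V i" "opaque_utility k S \<rho> ?V < utility p ?V i"
      using i(2) unfolding chooses_product_def by blast+
    ultimately show ?R unfolding R u0 u[OF i(1)] opaque_utility_def by linarith
  next
    assume ?R
    then have m0: "?V 0 < ?V m - r" "opaque_valuation k S ?V - \<rho> < ?V m - r" unfolding R by auto
    have "utility p ?V j < utility p ?V m" if "j \<in> insert 0 S - {m}" for j
    proof (cases "j = 0")
      case False
      with that have j: "j \<in> S" "j \<noteq> m" by auto
      then have "?V j \<le> ?V m" "?V j \<noteq> ?V m" using A_le[of j] m assms by auto
      then show ?thesis using j m u by simp
    qed (use m0 u[OF m(1)] u0 in simp)
    then have "chooses_product k S p \<rho> ?V m"
      using m0 u[OF m(1)] by (auto simp: chooses_product_def opaque_utility_def)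
    then show ?L using m by auto
  qed
qed

lemma eps_vector_measurable [measurable]:
  "(\<lambda>\<omega>. \<lambda>i\<in>S. exp (- \<epsilon> i \<omega>)) \<in> measurable M (PiM S (\<lambda>_. borel))"
  using S by (intro measurable_restrict) auto

lemmas cost_measurable [measurable] =
  borel_measurable_opaque_cost[OF finS S(2) k] borel_measurable_min_cost[OF finS S(2) k]

lemma costs_AE_nonneg:
  "0 \<le> b \<Longrightarrow> AE y in PiM S (\<lambda>_. exp1). Q y \<longrightarrow> 0 \<le> b * opaque_cost v k S y"
  "0 \<le> b \<Longrightarrow> AE y in PiM S (\<lambda>_. exp1). Q y \<longrightarrow> 0 \<le> b * min_cost v S y"
proof -
  show "0 \<le> b \<Longrightarrow> AE y in PiM S (\<lambda>_. exp1). Q y \<longrightarrow> 0 \<le> b * opaque_cost v k S y"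
    using AE_PiM_exp1_pos[OF finS]
    by eventually_elim (use opaque_cost_pos[OF finS S(2) k] in \<open>auto simp: less_imp_le intro!: mult_nonneg_nonneg\<close>)
  show "0 \<le> b \<Longrightarrow> AE y in PiM S (\<lambda>_. exp1). Q y \<longrightarrow> 0 \<le> b * min_cost v S y"
    using AE_PiM_exp1_pos[OF finS]
    by eventually_elim (use min_cost_pos[OF finS S(2) k] in \<open>auto simp: less_imp_le intro!: mult_nonneg_nonneg\<close>)
qed

lemma prob_opaque_eq: "prob_opaque M v \<epsilon> k S p \<rho> = opaque_share v k S (exp r) (exp \<rho>)"
  unfolding prob_opaque_def opaque_share_def chooses_opaque_iff
  using S zero_notin
  by (intro prob_threshold(1)[where R="\<lambda>y. exp \<rho> * opaque_cost v k S y \<le> exp r * min_cost v S y"]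
      finS costs_AE_nonneg) (auto simp: subset_eq)

text \<open>At a common price only the total share of the products enters the revenue. The choice
  events are disjoint, and their union differs from the event in
  \<open>chooses_product_Ex_iff\<close> only on the null set of ties.\<close>

lemma sum_prob_product_eq:
  "(\<Sum>i\<in>S. prob_product M v \<epsilon> k S p \<rho> i) = traditional_share v k S (exp r) (exp \<rho>)"
proof -
  let ?C = "\<lambda>i. {\<omega> \<in> space M. chooses_product k S p \<rho> (valuation v \<epsilon> \<omega>) i}"
  let ?D = "{\<omega> \<in> space M. exp r * min_cost v S (\<lambda>i\<in>S. exp (- \<epsilon> i \<omega>)) < exp (- \<epsilon> 0 \<omega>) \<and>
    exp r * min_cost v S (\<lambda>i\<in>S. exp (- \<epsilon> i \<omega>)) < exp \<rho> * opaque_cost v k S (\<lambda>i\<in>S. exp (- \<epsilon> i \<omega>))}"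
  have [measurable]: "(\<lambda>\<omega>. utility p (valuation v \<epsilon> \<omega>) i) \<in> borel_measurable M" if "i \<in> insert 0 S" for i
    using that valuation_measurable[of i] valuation_measurable[of 0] by (cases "i = 0") (auto simp: utility_def)
  have [measurable]: "(\<lambda>\<omega>. opaque_utility k S \<rho> (valuation v \<epsilon> \<omega>)) \<in> borel_measurable M"
    unfolding opaque_utility_def
    by (intro borel_measurable_diff borel_measurable_opaque_valuation[OF finS S(2) k]) auto
  have meas: "?C i \<in> events" if "i \<in> S" for i
  proof -
    have [measurable]: "Measurable.pred M (\<lambda>\<omega>. \<forall>j\<in>insert 0 S - {i}.
        utility p (valuation v \<epsilon> \<omega>) j < utility p (valuation v \<epsilon> \<omega>) i)"
      using finS that by (intro pred_intros_finite borel_measurable_pred_less) auto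
    have [measurable]: "i \<in> insert 0 S" using that by simp
    show ?thesis unfolding chooses_product_def by measurable
  qed
  have "?C i \<inter> ?C j = {}" if ij: "i \<in> S" "j \<in> S" "i \<noteq> j" for i j
  proof -
    have False if "chooses_product k S p \<rho> V i" "chooses_product k S p \<rho> V j" for V
    proof -
      have "utility p V j < utility p V i" "utility p V i < utility p V j"
        using that ij by (auto simp: chooses_product_def)
      then show False by simp
    qed
    then show ?thesis by blast
  qed
  then have "(\<Sum>i\<in>S. prob (?C i)) = prob (\<Union>i\<in>S. ?C i)"
    using meas finS by (intro finite_measure_finite_Union[symmetric]) (auto simp: disjoint_family_on_def)
  also have "\<dots> = prob ?D"
  proof (rule finite_measure_eq_AE)
    have "AE \<omega> in M. \<forall>i\<in>S. \<forall>j\<in>S. i \<noteq> j \<longrightarrow> valuation v \<epsilon> \<omega> i \<noteq> valuation v \<epsilon> \<omega> j"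
    proof (intro AE_finite_allI finS)
      fix i j assume ij: "i \<in> S" "j \<in> S"
      show "AE \<omega> in M. i \<noteq> j \<longrightarrow> valuation v \<epsilon> \<omega> i \<noteq> valuation v \<epsilon> \<omega> j"
      proof (cases "i = j")
        case False
        then have "AE \<omega> in M. (v i - v j) + \<epsilon> i \<omega> \<noteq> \<epsilon> j \<omega>"
          using ij S by (intro AE_no_tie) auto
        then show ?thesis
          by eventually_elim (use ij zero_notin in \<open>auto simp: valuation_def\<close>)
      qed simp
    qed
    then show "AE \<omega> in M. \<omega> \<in> (\<Union>i\<in>S. ?C i) \<longleftrightarrow> \<omega> \<in> ?D"
      by eventually_elim (use chooses_product_Ex_iff in auto)
    show "(\<Union>i\<in>S. ?C i) \<in> events" using meas finS by auto
    show "?D \<in> events" by measurable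
  qed
  also have "\<dots> = traditional_share v k S (exp r) (exp \<rho>)"
    unfolding traditional_share_def using S zero_notin
    by (intro prob_threshold(2)[where R="\<lambda>y. exp r * min_cost v S y < exp \<rho> * opaque_cost v k S y"]
        finS costs_AE_nonneg) (auto simp: subset_eq)
  finally show ?thesis by (simp add: prob_product_def)
qed

lemma Rev_eq_shares:
  "Rev_Opq M v \<epsilon> k S p \<rho> =
     r * traditional_share v k S (exp r) (exp \<rho>) + \<rho> * opaque_share v k S (exp r) (exp \<rho>)"
  using S p sum_prob_product_eq prob_opaque_eq
  by (simp add: Rev_Opq_def flip: sum_distrib_left)

end

end

section \<open>Revenue comparison\<close>

lemma threshold_cong:
  assumes "finite S" "S \<noteq> {}" "1 \<le> k" "\<And>i. i \<in> S \<Longrightarrow> y i = y' i"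
  shows "threshold v k S G b y = threshold v k S G b y'"
  unfolding threshold_def using opaque_cost_cong[OF assms(1-3), of y y'] min_cost_cong[OF assms(1-3), of y y']
    assms(4) by simp

text \<open>The coordinates are i.i.d., so labels can be moved into the valuations. Two assortments
  of equal size then become two valuation vectors on one index set, ready for coupling.\<close>

lemma no_purchase_reindex:
  assumes S: "finite S" "S \<noteq> {}" "1 \<le> k" and \<sigma>: "bij_betw \<sigma> S T"
  shows "no_purchase v k T G b = no_purchase (\<lambda>i. v (\<sigma> i)) k S G b"
proof -
  let ?v = "\<lambda>i. v (\<sigma> i)"
  note [measurable] = borel_measurable_threshold[OF S]
  have m [measurable]: "(\<lambda>y. \<lambda>i\<in>S. y (\<sigma> i)) \<in> measurable (PiM T (\<lambda>_. exp1)) (PiM S (\<lambda>_. exp1))"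
    using \<sigma> by (intro measurable_restrict) (auto simp: bij_betw_def)
  have "PiM S (\<lambda>_. exp1) = distr (PiM T (\<lambda>_. exp1)) (PiM S (\<lambda>_. exp1)) (\<lambda>y. \<lambda>i\<in>S. y (\<sigma> i))"
    using \<sigma> prob_space_exp1 by (intro distr_PiM_reindex[symmetric]) (auto simp: bij_betw_def)
  then have "no_purchase ?v k S G b
    = (\<integral>y. 1 - exp (- threshold ?v k S G b y) \<partial>distr (PiM T (\<lambda>_. exp1)) (PiM S (\<lambda>_. exp1)) (\<lambda>y. \<lambda>i\<in>S. y (\<sigma> i)))"
    by (simp add: no_purchase_def)
  also have "\<dots> = (\<integral>y. 1 - exp (- threshold ?v k S G b (\<lambda>i\<in>S. y (\<sigma> i))) \<partial>PiM T (\<lambda>_. exp1))"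
    by (rule integral_distr[OF m]) measurable
  also have "\<dots> = (\<integral>y. 1 - exp (- threshold v k T G b y) \<partial>PiM T (\<lambda>_. exp1))"
  proof -
    have "threshold ?v k S G b (\<lambda>i\<in>S. y (\<sigma> i)) = threshold ?v k S G b (\<lambda>i. y (\<sigma> i))" for y
      by (rule threshold_cong[OF S]) simp
    then show ?thesis
      unfolding threshold_def opaque_cost_reindex[OF S \<sigma>] min_cost_reindex[OF S \<sigma>] by simp
  qed
  finally show ?thesis by (simp add: no_purchase_def)
qed

text \<open>Coupling: for the same \<open>y\<close>, larger intrinsic valuations lower every cost,
  hence both order statistics and the threshold.\<close>

lemma no_purchase_mono:
  assumes S: "finite S" "S \<noteq> {}" "1 \<le> k" and bG: "0 < b" "b \<le> G"
    and v: "\<And>i. i \<in> S \<Longrightarrow> v i \<le> v' i"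
  shows "no_purchase v' k S G b \<le> no_purchase v k S G b"
  unfolding no_purchase_eq[OF S bG]
proof (intro diff_left_mono integral_mono_AE integrable_exp_threshold[OF S bG])
  show "AE y in PiM S (\<lambda>_. exp1). exp (- threshold v k S G b y) \<le> exp (- threshold v' k S G b y)"
    using AE_PiM_exp1_pos[OF S(1)]
  proof eventually_elim
    case (elim y)
    then have le: "exp (- v' i) * y i \<le> exp (- v i) * y i" if "i \<in> S" for i
      using v that by (intro mult_right_mono) (auto simp: less_imp_le)
    have "opaque_cost v' k S y \<le> opaque_cost v k S y" "min_cost v' S y \<le> min_cost v S y"
      using le by (auto intro: opaque_cost_mono[OF S] min_cost_mono[OF S])
    then have "threshold v' k S G b y \<le> threshold v k S G b y"
      unfolding threshold_def using bG by (intro min.mono mult_left_mono) auto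
    then show ?case by simp
  qed
qed

lemma shares_nonneg: "0 \<le> opaque_share v k S G b" "0 \<le> traditional_share v k S G b"
  by (simp_all add: opaque_share_def traditional_share_def)

lemma no_purchase_nonneg:
  assumes S: "finite S" "S \<noteq> {}" "1 \<le> k" and bG: "0 < b" "b \<le> G"
  shows "0 \<le> no_purchase v k S G b"
  unfolding no_purchase_def
  by (rule integral_nonneg_AE) (use threshold_AE_pos[OF S bG, of v] in \<open>auto elim!: eventually_mono\<close>)

text \<open>If the value vanished, the right side of \<open>share_identity\<close> would be 0; yet
  the shares would sum to 1 and the left side would be at least \<open>b\<close>.\<close>

lemma no_purchase_pos:
  assumes S: "finite S" "S \<noteq> {}" "1 \<le> k" and bG: "0 < b" "b \<le> G"
  shows "0 < no_purchase v k S G b"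
proof (rule ccontr)
  assume "\<not> 0 < no_purchase v k S G b"
  then have 0: "no_purchase v k S G b = 0" using no_purchase_nonneg[OF S bG, of v] by simp
  have "b * (opaque_share v k S G b + traditional_share v k S G b)
      \<le> G * traditional_share v k S G b + b * opaque_share v k S G b"
    using mult_right_mono[OF bG(2) shares_nonneg(2)[of v k S G b]] by (simp add: algebra_simps)
  then show False using share_identity[OF S bG, of v] shares(3)[OF S bG, of v] bG 0 by simp
qed

text \<open>At \<open>b = G\<close> the identity involves only the sum of the shares and becomes one
  linear equation, whose solution is the multinomial logit formula.\<close>

lemma no_purchase_without_discount:
  assumes S: "finite S" "S \<noteq> {}" "1 \<le> k" and G: "0 < G"
  shows "no_purchase v k S G G = G / (G + (\<Sum>i\<in>S. exp (v i)))"
proof -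
  have "G * (1 - no_purchase v k S G G) = (\<Sum>i\<in>S. exp (v i)) * no_purchase v k S G G"
    using share_identity[OF S G order_refl, of v] shares(3)[OF S G order_refl, of v]
    by (simp add: algebra_simps flip: distrib_left)
  moreover have "0 < G + (\<Sum>i\<in>S. exp (v i))" using G by (simp add: add_pos_nonneg sum_nonneg)
  ultimately show ?thesis by (simp add: field_simps)
qed

text \<open>With at most \<open>k\<close> products \<open>q\<close> is a best product at no higher
  price and wins ties, so the traditional share vanishes and the identity is again one linear
  equation.\<close>

lemma no_purchase_all_opaque:
  assumes S: "finite S" "S \<noteq> {}" "1 \<le> k" "card S \<le> k" and bG: "0 < b" "b \<le> G"
  shows "no_purchase v k S G b = b / (b + (\<Sum>i\<in>S. exp (v i)))"
proof -
  have "traditional_share v k S G b = 0"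
  proof -
    have "AE y in PiM S (\<lambda>_. exp1). exp (- (G * min_cost v S y)) *
        indicator {y. G * min_cost v S y < b * opaque_cost v k S y} y = (0::real)"
      using AE_PiM_exp1_pos[OF S(1)]
    proof eventually_elim
      case (elim y)
      then have "b * min_cost v S y \<le> G * min_cost v S y"
        using bG min_cost_pos[OF S(1-3), of y v] by (intro mult_right_mono) auto
      then show ?case by (simp add: opaque_cost_eq_min_cost[OF S])
    qed
    then show ?thesis unfolding traditional_share_def by (rule integral_eq_zero_AE)
  qed
  then have "b * (1 - no_purchase v k S G b) = (\<Sum>i\<in>S. exp (v i)) * no_purchase v k S G b"
    using share_identity[OF S(1-3) bG, of v] shares(3)[OF S(1-3) bG, of v] by simp
  moreover have "0 < b + (\<Sum>i\<in>S. exp (v i))" using bG by (simp add: add_pos_nonneg sum_nonneg)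
  ultimately show ?thesis by (simp add: field_simps)
qed

text \<open>The \<open>k\<close>-th largest cost is at least the smallest, so for
  \<open>b > G\<close> the opaque product almost surely loses to the best traditional one. What
  remains is the choice at a common price, described by \<open>b = G\<close>.\<close>

lemma shares_no_discount:
  assumes S: "finite S" "S \<noteq> {}" "1 \<le> k" and bG: "0 < G" "G < b"
  shows "opaque_share v k S G b = 0"
    and "traditional_share v k S G b = 1 - no_purchase v k S G G"
proof -
  have AE: "AE y in PiM S (\<lambda>_. exp1). G * min_cost v S y < b * opaque_cost v k S y"
    using AE_PiM_exp1_pos[OF S(1)]
  proof eventually_elim
    case (elim y)
    then have "G * min_cost v S y < b * min_cost v S y"
      using bG min_cost_pos[OF S, of y v] by (intro mult_strict_right_mono) auto
    also have "\<dots> \<le> b * opaque_cost v k S y"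
      using bG min_cost_le_opaque_cost[OF S] by (intro mult_left_mono) auto
    finally show ?case .
  qed
  show "opaque_share v k S G b = 0"
    unfolding opaque_share_def
    by (rule integral_eq_zero_AE) (use AE in \<open>auto elim!: eventually_mono\<close>)
  note [measurable] = borel_measurable_opaque_cost[OF S] borel_measurable_min_cost[OF S]
    borel_measurable_threshold[OF S]
  have "traditional_share v k S G b = (\<integral>y. exp (- threshold v k S G G y) \<partial>PiM S (\<lambda>_. exp1))"
    unfolding traditional_share_def
  proof (rule integral_cong_AE)
    show "AE y in PiM S (\<lambda>_. exp1). exp (- (G * min_cost v S y)) *
        indicator {y. G * min_cost v S y < b * opaque_cost v k S y} y = exp (- threshold v k S G G y)"
      using AE by eventually_elim
        (use min_cost_le_opaque_cost[OF S] bG in \<open>simp add: threshold_def min_absorb2 mult_left_mono\<close>)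
  qed measurable
  then show "traditional_share v k S G b = 1 - no_purchase v k S G G"
    using no_purchase_eq[OF S bG(1) order_refl, of v] by simp
qed

lemma continuous_no_purchase:
  assumes S: "finite S" "S \<noteq> {}" "1 \<le> k"
  shows "continuous_on UNIV (\<lambda>\<rho>. no_purchase v k S (exp r) (exp \<rho>))"
proof (rule continuous_on_sequentiallyI)
  fix u :: "nat \<Rightarrow> real" and a assume u: "u \<longlonglongrightarrow> a"
  interpret P: prob_space "PiM S (\<lambda>_. exp1)" by (rule prob_space_PiM_exp1)
  note [measurable] = borel_measurable_threshold[OF S]
  show "(\<lambda>n. no_purchase v k S (exp r) (exp (u n))) \<longlonglongrightarrow> no_purchase v k S (exp r) (exp a)"
    unfolding no_purchase_def
  proof (rule integral_dominated_convergence[where w="\<lambda>_. 1"])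
    show "AE y in PiM S (\<lambda>_. exp1). (\<lambda>n. 1 - exp (- threshold v k S (exp r) (exp (u n)) y))
        \<longlonglongrightarrow> 1 - exp (- threshold v k S (exp r) (exp a) y)"
      unfolding threshold_def by (intro AE_I2 tendsto_intros u)
    show "AE y in PiM S (\<lambda>_. exp1). norm (1 - exp (- threshold v k S (exp r) (exp (u n)) y)) \<le> 1" for n
      using AE_PiM_exp1_pos[OF S(1)]
      by eventually_elim (use threshold_pos[OF S] in \<open>auto simp: less_imp_le\<close>)
  qed auto
qed

section \<open>Revenue in terms of the weight and the no-purchase probability\<close>

context gumbel_market
begin

context
  fixes k :: nat and v p :: "nat \<Rightarrow> real" and r :: real
  assumes k: "1 \<le> k" and p: "\<And>i. i \<in> {1..n} \<Longrightarrow> p i = r"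
begin

abbreviation "weight S \<equiv> \<Sum>i\<in>S. exp (v i)"
abbreviation "Rev S \<rho> \<equiv> Rev_Opq M v \<epsilon> k S p \<rho>"
abbreviation "lost S \<rho> \<equiv> no_purchase v k S (exp r) (exp \<rho>)"

lemma S_facts:
  assumes "S \<subseteq> {1..n}" "S \<noteq> {}"
  shows "finite S" "0 < weight S" "\<And>i. i \<in> S \<Longrightarrow> p i = r"
  using assms finite_subset[OF assms(1)] p by (auto intro!: sum_pos)

lemma Rev_no_discount:
  assumes S: "S \<subseteq> {1..n}" "S \<noteq> {}" and "r \<le> \<rho>"
  shows "Rev S \<rho> = r * weight S / (exp r + weight S)"
proof -
  note f = S_facts[OF S]
  have "Rev S \<rho> = r * (1 - no_purchase v k S (exp r) (exp r))"
  proof (cases "\<rho> = r")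
    \<comment> \<open>An opaque sale earns the same price here, so only the total purchase
      probability counts.\<close>
    case True
    then show ?thesis
      using shares(3)[OF f(1) S(2) k _ order_refl, of "exp r" v]
      by (simp add: Rev_eq_shares[where p=p and r=r, OF S k f(3)] flip: distrib_left)
  next
    case False
    with assms have "exp r < exp \<rho>" by simp
    from shares_no_discount[OF f(1) S(2) k _ this, of v] show ?thesis
      by (simp add: Rev_eq_shares[where p=p and r=r, OF S k f(3)])
  qed
  also have "\<dots> = r * weight S / (exp r + weight S)"
  proof -
    have "exp r + weight S \<noteq> 0" using add_pos_pos[OF exp_gt_zero f(2)] by (metis less_irrefl)
    then have "1 - exp r / (exp r + weight S) = weight S / (exp r + weight S)"
      by (simp add: diff_divide_eq_iff)
    then show ?thesis by (simp add: no_purchase_without_discount[OF f(1) S(2) k])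
  qed
  finally show ?thesis .
qed

text \<open>The sum of the shares and \<open>share_identity\<close> form a linear system with
  distinct coefficients \<open>exp r\<close> and \<open>exp \<rho>\<close>, which determines both
  shares. The second claim is nonnegativity of the opaque share.\<close>

lemma Rev_discount:
  assumes S: "S \<subseteq> {1..n}" "S \<noteq> {}" and "\<rho> < r"
  defines "\<kappa> \<equiv> (r - \<rho>) / (exp r - exp \<rho>)"
  shows "Rev S \<rho> = r - \<kappa> * exp r + lost S \<rho> * (\<kappa> * (exp r + weight S) - r)"
    and "lost S \<rho> * (exp r + weight S) \<le> exp r"
proof -
  note f = S_facts[OF S]
  define T where "T = traditional_share v k S (exp r) (exp \<rho>)"
  define Q where "Q = opaque_share v k S (exp r) (exp \<rho>)"
  have lt: "exp \<rho> < exp r" using assms by simp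
  then have le: "exp \<rho> \<le> exp r" by simp
  have T: "T = 1 - lost S \<rho> - Q"
    using shares(3)[OF f(1) S(2) k _ le, of v] by (simp add: T_def Q_def)
  have "exp r * T + exp \<rho> * Q = weight S * lost S \<rho>"
    using share_identity[OF f(1) S(2) k _ le, of v] by (simp add: T_def Q_def)
  then have eq: "Q * (exp r - exp \<rho>) = exp r - lost S \<rho> * (exp r + weight S)"
    unfolding T by (simp add: algebra_simps)
  have Q: "Q = (exp r - lost S \<rho> * (exp r + weight S)) / (exp r - exp \<rho>)"
    unfolding eq[symmetric] using lt by simp
  have "0 \<le> Q" by (simp add: Q_def shares_nonneg)
  then have "0 \<le> Q * (exp r - exp \<rho>)" using lt by simp
  then show "lost S \<rho> * (exp r + weight S) \<le> exp r" unfolding eq by simp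
  have "Rev S \<rho> = r * T + \<rho> * Q"
    unfolding T_def Q_def by (rule Rev_eq_shares[where p=p and r=r, OF S k f(3)])
  also have "\<dots> = r * (1 - lost S \<rho>) - (r - \<rho>) * Q" unfolding T by (simp add: algebra_simps)
  also have "(r - \<rho>) * Q = \<kappa> * (exp r - lost S \<rho> * (exp r + weight S))"
    by (simp add: Q \<kappa>_def)
  finally show "Rev S \<rho> = r - \<kappa> * exp r + lost S \<rho> * (\<kappa> * (exp r + weight S) - r)"
    by (simp add: algebra_simps)
qed

text \<open>If r \<le> \<kappa> (exp r + weight S), then the discount does not pay for S and T without discount is
  better than S; otherwise T is better at the same opaque price.\<close>

lemma Rev_improve:
  assumes S: "S \<subseteq> {1..n}" "S \<noteq> {}" and T: "T \<subseteq> {1..n}" "T \<noteq> {}"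
    and r: "0 < r" and W: "weight S < weight T"
    and lost: "\<rho> < r \<Longrightarrow> lost T \<rho> \<le> lost S \<rho>"
  shows "Rev S \<rho> < Rev T r \<or> Rev S \<rho> < Rev T \<rho>"
proof -
  note f = S_facts[OF S] and g = S_facts[OF T]
  define G where "G = exp r"
  have G: "0 < G" by (simp add: G_def)
  have mnl: "r * weight S / (G + weight S) < r * weight T / (G + weight T)"
  proof -
    have "r * G * weight S < r * G * weight T" using r G W by simp
    then show ?thesis using G f(2) g(2)
      by (simp add: divide_less_eq less_divide_eq add_pos_pos algebra_simps)
  qed
  show ?thesis
  proof (cases "\<rho> < r")
    case False
    then show ?thesis using mnl Rev_no_discount[OF S] Rev_no_discount[OF T] by (simp add: G_def)
  next
    case True
    define \<kappa> where "\<kappa> = (r - \<rho>) / (exp r - exp \<rho>)"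
    have \<kappa>: "0 < \<kappa>" unfolding \<kappa>_def using True by simp
    have RS: "Rev S \<rho> = r - \<kappa> * G + lost S \<rho> * (\<kappa> * (G + weight S) - r)"
      and RT: "Rev T \<rho> = r - \<kappa> * G + lost T \<rho> * (\<kappa> * (G + weight T) - r)"
      and up: "lost S \<rho> * (G + weight S) \<le> G"
      using Rev_discount[OF S True] Rev_discount[OF T True] by (simp_all add: \<kappa>_def G_def)
    show ?thesis
    proof (cases "r \<le> \<kappa> * (G + weight S)")
      case c: True
      have pos: "0 < G + weight S" using G f(2) by simp
      have "lost S \<rho> \<le> G / (G + weight S)" using up pos by (simp add: field_simps)
      then have "lost S \<rho> * (\<kappa> * (G + weight S) - r) \<le> G / (G + weight S) * (\<kappa> * (G + weight S) - r)"
        using c by (intro mult_right_mono) auto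
      also have "\<dots> = \<kappa> * G - r * G / (G + weight S)" using pos by (simp add: field_simps)
      finally have "Rev S \<rho> \<le> r - r * G / (G + weight S)" unfolding RS by simp
      also have "\<dots> = r * weight S / (G + weight S)" using pos by (simp add: field_simps)
      also note mnl
      finally show ?thesis using Rev_no_discount[OF T order_refl] by (simp add: G_def)
    next
      case False
      \<comment> \<open>The factor is negative in this case, so
        \<open>lost T \<rho> \<le> lost S \<rho>\<close> helps. Strictness then comes from the
        larger weight, multiplied by the positive \<open>lost T \<rho>\<close>.\<close>
      have "lost S \<rho> * (\<kappa> * (G + weight S) - r) \<le> lost T \<rho> * (\<kappa> * (G + weight S) - r)"
        using False lost[OF True] by (intro mult_right_mono_neg) auto
      also have "\<dots> < lost T \<rho> * (\<kappa> * (G + weight T) - r)"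
        using no_purchase_pos[OF g(1) T(2) k, of "exp \<rho>" "exp r" v] True W \<kappa>
        by (intro mult_strict_left_mono) auto
      finally show ?thesis unfolding RS RT by simp
    qed
  qed
qed

section \<open>Exchange, enlargement and relabelling of assortments\<close>

lemma weight_reindex: "bij_betw \<sigma> S T \<Longrightarrow> weight T = (\<Sum>i\<in>S. exp (v (\<sigma> i)))"
  by (rule sum.reindex_bij_betw[symmetric])

text \<open>Giving \<open>j\<close> the label \<open>i\<close> turns the exchange into an increase
  of a single valuation on the fixed index set \<open>S\<close>, where the coupling applies.\<close>

lemma Rev_swap:
  assumes S: "S \<subseteq> {1..n}" and r: "0 < r" and i: "i \<in> S" "j \<in> {1..n}" "j \<notin> S" "v i < v j"
  shows "\<exists>T\<subseteq>{1..n}. \<exists>\<rho>'\<in>{r, \<rho>}. Rev S \<rho> < Rev T \<rho>'"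
proof -
  have S': "S \<noteq> {}" using i by auto
  note f = S_facts[OF S S']
  define T where "T = insert j (S - {i})"
  define \<sigma> where "\<sigma> = id(i := j)"
  have T: "T \<subseteq> {1..n}" "T \<noteq> {}" using S i by (auto simp: T_def)
  have bij: "bij_betw \<sigma> S T"
    using i by (auto simp: bij_betw_def inj_on_def \<sigma>_def T_def)
  have le: "v l \<le> v (\<sigma> l)" for l using i by (simp add: \<sigma>_def)
  have "weight S < weight T"
    unfolding weight_reindex[OF bij]
    by (rule sum_strict_mono_ex1) (use f i le in \<open>auto intro!: bexI[of _ i] simp: \<sigma>_def\<close>)
  moreover have "lost T \<rho> \<le> lost S \<rho>" if "\<rho> < r"
    unfolding no_purchase_reindex[OF f(1) S' k bij]
    using that le by (intro no_purchase_mono f S' k) auto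
  ultimately show ?thesis using Rev_improve[OF S S' T r, of \<rho>] T by blast
qed

text \<open>The enlarged set still has at most \<open>k\<close> products, so the closed form of the
  no-purchase probability holds for both sets and decreases in the weight. The empty set earns 0 and
  is treated apart.\<close>

lemma Rev_enlarge:
  assumes S: "S \<subseteq> {1..n}" and r: "0 < r" and c: "card S < k" "k \<le> n"
  shows "\<exists>T\<subseteq>{1..n}. \<exists>\<rho>'\<in>{r, \<rho>}. Rev S \<rho> < Rev T \<rho>'"
proof -
  have "card S < card {1..n}" using c by simp
  then obtain j where j: "j \<in> {1..n}" "j \<notin> S"
    by (metis S card_subset_eq finite_atLeastAtMost less_irrefl subsetI subset_antisym)
  define T where "T = insert j S"
  have T: "T \<subseteq> {1..n}" "T \<noteq> {}" using S j by (auto simp: T_def)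
  note g = S_facts[OF T]
  show ?thesis
  proof (cases "S = {}")
    case True
    have "0 < Rev T r" unfolding Rev_no_discount[OF T order_refl]
      using g(2) r by (simp add: add_pos_pos)
    then show ?thesis using True T by (auto simp: Rev_Opq_def)
  next
    case S': False
    note f = S_facts[OF S S']
    have W: "weight S < weight T" using f(1) j by (simp add: T_def)
    have "lost T \<rho> \<le> lost S \<rho>" if "\<rho> < r"
    proof -
      have "card T \<le> k" using c j f(1) by (simp add: T_def)
      then have "lost T \<rho> = exp \<rho> / (exp \<rho> + weight T)"
        using that by (intro no_purchase_all_opaque g T k) auto
      also have "\<dots> \<le> exp \<rho> / (exp \<rho> + weight S)"
        using f(2) g(2) W by (intro divide_left_mono) (auto intro!: mult_pos_pos add_pos_pos)
      also have "\<dots> = lost S \<rho>"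
        using that c by (intro no_purchase_all_opaque[symmetric] f S' k) auto
      finally show ?thesis .
    qed
    then show ?thesis using Rev_improve[OF S S' T r W, of \<rho>] T by blast
  qed
qed

text \<open>This handles equal valuations: monotonicity in both directions equates the no-purchase
  probabilities, and the weights agree as well.\<close>

lemma Rev_reindex:
  assumes S: "S \<subseteq> {1..n}" and T: "T \<subseteq> {1..n}" and bij: "bij_betw \<sigma> S T"
    and v: "\<And>i. i \<in> S \<Longrightarrow> v (\<sigma> i) = v i"
  shows "Rev T \<rho> = Rev S \<rho>"
proof (cases "S = {}")
  case True
  then show ?thesis using bij by (auto simp: bij_betw_def Rev_Opq_def)
next
  case S': False
  then have T': "T \<noteq> {}" using bij by (auto simp: bij_betw_def)
  note f = S_facts[OF S S']
  have W: "weight T = weight S" unfolding weight_reindex[OF bij] using v by simp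
  have "lost T \<rho> = lost S \<rho>" if "\<rho> < r"
    unfolding no_purchase_reindex[OF f(1) S' k bij]
    using that v by (intro antisym no_purchase_mono f S' k) auto
  then show ?thesis
    using Rev_no_discount[OF S S', of \<rho>] Rev_no_discount[OF T T', of \<rho>]
      Rev_discount(1)[OF S S', of \<rho>] Rev_discount(1)[OF T T', of \<rho>] W
    by (cases "\<rho> < r") auto
qed

section \<open>Existence of an optimal opaque price and of an optimal assortment\<close>

lemma Rev_attains_max:
  assumes S: "S \<subseteq> {1..n}" and r: "0 \<le> r"
  shows "\<exists>\<rho>\<ge>0. \<forall>\<rho>'\<ge>0. Rev S \<rho>' \<le> Rev S \<rho>"
proof (cases "S = {}")
  case True
  then show ?thesis by (auto simp: Rev_Opq_def)
next
  case S': False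
  note f = S_facts[OF S S']
  define Q where "Q = (\<lambda>\<rho>. opaque_share v k S (exp r) (exp \<rho>))"
  \<comment> \<open>A form of the revenue without the quotient \<kappa>, which is 0 / 0 at the
    endpoint \<rho> = r.\<close>
  define F where "F = (\<lambda>\<rho>. r * (1 - lost S \<rho>) - (r - \<rho>) * Q \<rho>)"
  have cont_lost: "continuous_on A (lost S)" for A
    using continuous_no_purchase[OF f(1) S' k, of v r] by (rule continuous_on_subset) simp
  have F: "Rev S \<rho> = F \<rho>" if "\<rho> \<le> r" for \<rho>
  proof -
    have t: "traditional_share v k S (exp r) (exp \<rho>) = 1 - lost S \<rho> - Q \<rho>"
      using shares(3)[OF f(1) S' k, of "exp \<rho>" "exp r" v] that by (simp add: Q_def)
    have "Rev S \<rho> = r * traditional_share v k S (exp r) (exp \<rho>) + \<rho> * Q \<rho>"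
      unfolding Q_def by (rule Rev_eq_shares[where p=p and r=r, OF S S' k f(3)])
    then show ?thesis unfolding t F_def by (simp add: algebra_simps)
  qed
  have Q01: "0 \<le> Q \<rho>" "Q \<rho> \<le> 1" if "\<rho> \<le> r" for \<rho>
  proof -
    have le: "exp \<rho> \<le> exp r" using that by simp
    show "0 \<le> Q \<rho>" by (simp add: Q_def shares_nonneg)
    show "Q \<rho> \<le> 1"
      using shares(3)[OF f(1) S' k exp_gt_zero le, of v] no_purchase_nonneg[OF f(1) S' k exp_gt_zero le, of v]
        shares_nonneg(2)[of v k S "exp r" "exp \<rho>"] unfolding Q_def by linarith
  qed
  have "continuous_on {0..r} (Rev S)"
    unfolding continuous_on_def
  proof
    fix x assume x: "x \<in> {0..r}"
    show "(Rev S \<longlongrightarrow> Rev S x) (at x within {0..r})"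
    proof (cases "x = r")
      case False
      \<comment> \<open>The integrand of \<open>Q\<close> jumps with the price. Below
        \<open>r\<close> the formula of \<open>Rev_discount\<close> replaces it by the no-purchase
        probability, whose continuity is known.\<close>
      define H where "H = (\<lambda>\<rho>. r - (r - \<rho>) / (exp r - exp \<rho>) * exp r
        + lost S \<rho> * ((r - \<rho>) / (exp r - exp \<rho>) * (exp r + weight S) - r))"
      have H: "Rev S \<rho> = H \<rho>" if "\<rho> < r" for \<rho>
        unfolding H_def by (rule Rev_discount(1)[OF S S' that])
      have "continuous_on {..<r} H"
        unfolding H_def by (intro continuous_intros cont_lost) auto
      moreover have "x < r" using x False by simp
      ultimately have "(H \<longlongrightarrow> H x) (at x)"
        by (metis at_within_open continuous_on_def lessThan_iff open_lessThan)
      then have "(H \<longlongrightarrow> H x) (at x within {0..r})" by (rule tendsto_within_subset) simp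
      moreover have "eventually (\<lambda>\<rho>. H \<rho> = Rev S \<rho>) (at x within {0..r})"
      proof -
        have "eventually (\<lambda>\<rho>. \<rho> < r) (at x within {0..r})"
          using \<open>x < r\<close> by (intro order_tendstoD(2)[OF tendsto_ident_at])
        then show ?thesis by eventually_elim (simp add: H)
      qed
      ultimately show ?thesis unfolding H[OF \<open>x < r\<close>] by (rule Lim_transform_eventually)
    next
      case True
      \<comment> \<open>At the endpoint boundedness of \<open>Q\<close> suffices, as it carries the
        vanishing factor r - \<rho>.\<close>
      have "((\<lambda>\<rho>. (r - \<rho>) * Q \<rho>) \<longlongrightarrow> 0) (at r within {0..r})"
      proof (rule Lim_null_comparison)
        show "eventually (\<lambda>\<rho>. norm ((r - \<rho>) * Q \<rho>) \<le> r - \<rho>) (at r within {0..r})"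
          unfolding eventually_at_filter
          by (intro always_eventually allI impI) (use Q01 in \<open>auto simp: abs_mult mult_left_le\<close>)
        have "((\<lambda>\<rho>. r - \<rho>) \<longlongrightarrow> r - r) (at r within {0..r})" by (intro tendsto_intros)
        then show "((\<lambda>\<rho>. r - \<rho>) \<longlongrightarrow> 0) (at r within {0..r})" by simp
      qed
      moreover have "(lost S \<longlongrightarrow> lost S r) (at r within {0..r})"
        using cont_lost[of "{0..r}"] r by (simp add: continuous_on_def)
      ultimately have "(F \<longlongrightarrow> r * (1 - lost S r) - 0) (at r within {0..r})"
        unfolding F_def by (intro tendsto_intros)
      then have "(F \<longlongrightarrow> F r) (at r within {0..r})" by (simp add: F_def)
      moreover have "eventually (\<lambda>\<rho>. F \<rho> = Rev S \<rho>) (at r within {0..r})"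
        unfolding eventually_at_filter by (intro always_eventually) (simp add: F)
      ultimately show ?thesis unfolding True F[OF order_refl] by (rule Lim_transform_eventually)
    qed
  qed
  then obtain \<rho> where \<rho>: "\<rho> \<in> {0..r}" "\<And>\<rho>'. \<rho>' \<in> {0..r} \<Longrightarrow> Rev S \<rho>' \<le> Rev S \<rho>"
    using continuous_attains_sup[of "{0..r}" "Rev S"] r by auto
  \<comment> \<open>From \<open>r\<close> on the revenue is constant, so the maximizer on the
    compact interval is one over all nonnegative prices.\<close>
  have "Rev S \<rho>' \<le> Rev S \<rho>" if "0 \<le> \<rho>'" for \<rho>'
  proof (cases "\<rho>' \<le> r")
    case False
    then have "Rev S \<rho>' = Rev S r"
      using Rev_no_discount[OF S S', of \<rho>'] Rev_no_discount[OF S S', of r] by simp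
    then show ?thesis using \<rho>(2)[of r] r by simp
  qed (use that \<rho> in auto)
  then show ?thesis using \<rho>(1) by auto
qed

lemma exists_optimal_assortment:
  assumes r: "0 \<le> r"
  shows "\<exists>S. optimal_assortment M v \<epsilon> k n p S"
proof -
  obtain \<rho> where \<rho>: "\<And>S. S \<subseteq> {1..n} \<Longrightarrow> 0 \<le> \<rho> S \<and> (\<forall>\<rho>'\<ge>0. Rev S \<rho>' \<le> Rev S (\<rho> S))"
    using Rev_attains_max[OF _ r] by metis
  let ?R = "(\<lambda>S. Rev S (\<rho> S)) ` Pow {1..n}"
  have "Max ?R \<in> ?R" by (intro Max_in) auto
  then obtain S where S: "S \<subseteq> {1..n}" "Max ?R = Rev S (\<rho> S)" by auto
  have max: "Rev T (\<rho> T) \<le> Rev S (\<rho> S)" if "T \<subseteq> {1..n}" for T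
    unfolding S(2)[symmetric] using that by (intro Max_ge) auto
  have "Rev T \<rho>' \<le> Rev S (\<rho> S)" if "T \<subseteq> {1..n}" "0 \<le> \<rho>'" for T \<rho>'
    using \<rho>[OF that(1)] max[OF that(1)] that(2) by (meson order_trans)
  then show ?thesis using S(1) \<rho>[OF S(1)] unfolding optimal_assortment_def by blast
qed

text \<open>Both improving moves end at one of the admissible prices \<open>r\<close> and
  \<open>\<rho>\<close>, so neither is available at an optimum.\<close>

lemma optimal_assortment_top:
  assumes "optimal_assortment M v \<epsilon> k n p S" and r: "0 < r" and "k \<le> n"
  shows "S \<subseteq> {1..n}" "k \<le> card S" "\<And>i j. i \<in> S \<Longrightarrow> j \<in> {1..n} - S \<Longrightarrow> v j \<le> v i"
proof -
  obtain \<rho> where S: "S \<subseteq> {1..n}" and \<rho>: "0 \<le> \<rho>"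
    and max: "\<And>T \<rho>'. T \<subseteq> {1..n} \<Longrightarrow> 0 \<le> \<rho>' \<Longrightarrow> Rev T \<rho>' \<le> Rev S \<rho>"
    using assms(1) unfolding optimal_assortment_def by blast
  have no: "\<not> (\<exists>T\<subseteq>{1..n}. \<exists>\<rho>'\<in>{r, \<rho>}. Rev S \<rho> < Rev T \<rho>')"
  proof clarify
    fix T \<rho>' assume T: "T \<subseteq> {1..n}" "\<rho>' \<in> {r, \<rho>}" "Rev S \<rho> < Rev T \<rho>'"
    then have "0 \<le> \<rho>'" using \<rho> r by auto
    with max[OF T(1)] T(3) show False by (meson not_le)
  qed
  show "S \<subseteq> {1..n}" by (rule S)
  show "k \<le> card S" using Rev_enlarge[OF S r _ assms(3), of \<rho>] no by (meson not_le)
  show "v j \<le> v i" if "i \<in> S" "j \<in> {1..n} - S" for i j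
    using Rev_swap[OF S r that(1), of j \<rho>] that no by (meson DiffE not_le)
qed

end

end

section \<open>From a set of top valuations to an initial segment\<close>

lemma exists_permutation_to_initial_segment:
  fixes v :: "nat \<Rightarrow> real"
  assumes S: "S \<subseteq> {1..n}"
    and top: "\<And>i j. i \<in> S \<Longrightarrow> j \<in> {1..n} - S \<Longrightarrow> v j \<le> v i"
    and v: "\<forall>i\<in>{1..n}. \<forall>j\<in>{1..n}. i \<le> j \<longrightarrow> v j \<le> v i"
  shows "\<exists>\<sigma>. \<sigma> permutes {1..n} \<and> (\<forall>i\<in>{1..n}. v (\<sigma> i) = v i) \<and> \<sigma> ` S = {1..card S}"
proof -
  define T where "T = {1..card S}"
  define A where "A = S - T"
  define B where "B = T - S"
  have fin: "finite S" using S finite_subset by blast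
  have "card S \<le> n" using card_mono[OF _ S] by simp
  then have T: "T \<subseteq> {1..n}" "finite T" "card T = card S" by (auto simp: T_def)
  have "card A = card B"
    unfolding A_def B_def using fin T by (simp add: card_Diff_subset_Int Int_commute)
  then obtain f where f: "bij_betw f A B"
    using finite_same_card_bij[of A B] fin T by (auto simp: A_def B_def)
  \<comment> \<open>\<open>top\<close> gives one inequality, as only \<open>a\<close> lies in
    \<open>S\<close>; the ordering of \<open>v\<close> gives the other, as \<open>b\<close> is at
    most \<open>card S\<close> and \<open>a\<close> exceeds it.\<close>
  have eq: "v a = v b" if "a \<in> A" "b \<in> B" for a b
  proof (rule antisym)
    show "v b \<le> v a" using that T top[of a b] by (auto simp: A_def B_def)
    have "b \<le> a" using that S by (force simp: A_def B_def T_def)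
    moreover have "a \<in> {1..n}" "b \<in> {1..n}" using that S T by (auto simp: A_def B_def)
    ultimately show "v a \<le> v b" using v by blast
  qed
  define g where "g = inv_into A f"
  have g: "bij_betw g B A" unfolding g_def by (rule bij_betw_inv_into[OF f])
  have fB: "f a \<in> B" "g (f a) = a" if "a \<in> A" for a
    using f that by (auto simp: g_def bij_betw_def)
  have gA: "g b \<in> A" "f (g b) = b" if "b \<in> B" for b
    using g f that by (auto simp: g_def bij_betw_def f_inv_into_f)
  \<comment> \<open>Exchanging \<open>A\<close> and \<open>B\<close> along \<open>f\<close> is an
    involution, from which bijectivity is immediate.\<close>
  define \<sigma> where "\<sigma> = (\<lambda>x. if x \<in> A then f x else if x \<in> B then g x else x)"
  have AB: "A \<inter> B = {}" by (auto simp: A_def B_def)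
  have inv: "\<sigma> (\<sigma> x) = x" for x
    using fB gA AB by (auto simp: \<sigma>_def)
  have "\<sigma> permutes {1..n}"
    unfolding permutes_def
  proof (intro conjI allI impI)
    show "\<sigma> x = x" if "x \<notin> {1..n}" for x
      using that S T by (auto simp: \<sigma>_def A_def B_def)
    show "\<exists>!x. \<sigma> x = y" for y using inv by metis
  qed
  moreover have "v (\<sigma> i) = v i" for i
    using eq[of i "f i"] eq[of "g i" i] fB gA by (auto simp: \<sigma>_def)
  moreover have "\<sigma> ` S = T"
  proof -
    have "\<sigma> ` A = B" using f by (auto simp: \<sigma>_def bij_betw_def)
    moreover have "\<sigma> ` (S \<inter> T) = S \<inter> T" by (auto simp: \<sigma>_def A_def B_def)
    moreover have "S = (S \<inter> T) \<union> A" "T = (S \<inter> T) \<union> B" by (auto simp: A_def B_def)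
    ultimately show ?thesis by (metis image_Un)
  qed
  ultimately show ?thesis unfolding T_def by blast
qed

theorem theorem3:
  fixes M :: "'a measure" and \<epsilon> :: "nat \<Rightarrow> 'a \<Rightarrow> real"
    and v p :: "nat \<Rightarrow> real" and r :: real and n k :: nat
  assumes "prob_space M"
    and "iid_gumbel M {0..n} \<epsilon>"
    and "k \<in> {1..n}"
    and "0 \<le> r"
    and "\<forall>i\<in>{1..n}. p i = r"
    and "\<forall>i\<in>{1..n}. \<forall>j\<in>{1..n}. i \<le> j \<longrightarrow> v j \<le> v i"
  shows "(\<exists>j\<in>{k..n}. optimal_assortment M v \<epsilon> k n p {1..j}) \<and>
    (0 < r \<longrightarrow>
      (\<forall>S. optimal_assortment M v \<epsilon> k n p S \<longrightarrow>
        (\<exists>j\<in>{k..n}. \<exists>\<sigma>. \<sigma> permutes {1..n} \<and> (\<forall>i\<in>{1..n}. v (\<sigma> i) = v i) \<and> \<sigma> ` S = {1..j})))"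
proof -
  interpret gumbel_market M \<epsilon> n
    using assms by (simp add: gumbel_market_def gumbel_market_axioms_def)
  have k: "1 \<le> k" "k \<le> n" and p: "\<And>i. i \<in> {1..n} \<Longrightarrow> p i = r" using assms by auto
  have perm: "\<exists>j\<in>{k..n}. \<exists>\<sigma>. \<sigma> permutes {1..n} \<and> (\<forall>i\<in>{1..n}. v (\<sigma> i) = v i) \<and> \<sigma> ` S = {1..j}"
    if "0 < r" and opt: "optimal_assortment M v \<epsilon> k n p S" for S
  proof -
    note top = optimal_assortment_top[where p=p and r=r, OF k(1) p opt that(1) k(2)]
    have "card S \<le> n" using card_mono[OF _ top(1)] by simp
    then show ?thesis
      using exists_permutation_to_initial_segment[OF top(1,3) assms(6)] top(2)
      by (intro bexI[of _ "card S"]) auto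
  qed
  moreover have "\<exists>j\<in>{k..n}. optimal_assortment M v \<epsilon> k n p {1..j}"
  proof (cases "r = 0")
    case True
    \<comment> \<open>At r = 0 every admissible opaque price is no discount, so each assortment is
      optimal and \<open>{1..k}\<close> serves as witness.\<close>
    have "Rev_Opq M v \<epsilon> k S p \<rho> = 0" if "S \<subseteq> {1..n}" "0 \<le> \<rho>" for S \<rho>
      using Rev_no_discount[where p=p and r=r, OF k(1) p that(1)] that(2) True by (cases "S = {}") (auto simp: Rev_Opq_def)
    then have "optimal_assortment M v \<epsilon> k n p {1..k}"
      using k by (auto simp: optimal_assortment_def)
    then show ?thesis using k by auto
  next
    case False
    then have r: "0 < r" using assms(4) by simp
    obtain S where opt: "optimal_assortment M v \<epsilon> k n p S"
      using exists_optimal_assortment[where p=p and r=r, OF k(1) p assms(4)] by blast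
    obtain j \<sigma> where j: "j \<in> {k..n}" and \<sigma>: "\<sigma> permutes {1..n}" "\<forall>i\<in>{1..n}. v (\<sigma> i) = v i" "\<sigma> ` S = {1..j}"
      using perm[OF r opt] by blast
    have S: "S \<subseteq> {1..n}" using opt by (simp add: optimal_assortment_def)
    have "bij_betw \<sigma> S {1..j}"
      using \<sigma> permutes_inj_on[OF \<sigma>(1)] by (simp add: bij_betw_def)
    \<comment> \<open>Revenues agree at every opaque price, so the optimality of \<open>S\<close>
      passes to the initial segment.\<close>
    then have "Rev_Opq M v \<epsilon> k {1..j} p \<rho> = Rev_Opq M v \<epsilon> k S p \<rho>" for \<rho>
      using S \<sigma>(2) j by (intro Rev_reindex[where p=p and r=r and \<sigma>=\<sigma>, OF k(1) p]) auto
    then have "optimal_assortment M v \<epsilon> k n p {1..j}"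
      using opt j by (auto simp: optimal_assortment_def)
    then show ?thesis using j by blast
  qed
  ultimately show ?thesis by blast
qed

end
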